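(* Let $t>0$ be arbitrary and $A\in U(2)$. Then for any closed curve $\Gamma$ in $\mathbb C$, $(M^3_{A\Gamma},h_t)$ has subexponential growth.
   Context: Eguchi--Hanson space: $T^*\mathbb P^1(\mathbb C)$ is realized as $H^2=\{(\alpha,\beta,\gamma)\in(\mathbb C^2\setminus\{0\})\times\mathbb C\}/\sim$, where $(\alpha,\beta,\gamma)\sim(A\alpha,A\beta,\gamma/A^2)$ for $A\in\mathbb C^*$; the projection is $p([\alpha,\beta,\gamma])=\alpha/\beta\in\mathbb C\cup\{\infty\}=\mathbb P^1(\mathbb C)$. The complement of the zero section $\{\gamma=0\}$ is identified with $(\mathbb C^2\setminus\{0\})/\{\pm1\}$ by $[\alpha,\beta,\gamma]\mapsto \pm(z_1,z_2)=\pm(\alpha\sqrt\gamma,\beta\sqrt\gamma)$. Put $u_1=|z_1|^2+|z_2|^2$ and $f_t=\sqrt{u_1^2+t^4}+t^2\log\frac{u_1}{\sqrt{u_1^2+t^4}+t^2}$. The form $\omega_t=i\partial\bar\partial f_t$ extends to a Kähler form on $H^2$, and $g_t(X,Y)=\omega_t(X,JY)$ is the Eguchi--Hanson metric ($J$ the complex structure). For a smooth curve $\Gamma$, $M^3_\Gamma=p^{-1}(\Gamma)\subset H^2$ with the metric $h_t$ induced by $g_t$; for closed $\Gamma$ it is complete. $U(2)$ acts on $\mathbb C\cup\{\infty\}$ by Möbius transforms $z\mapsto\frac{az+b}{cz+d}$. An open complete Riemannian manifold $M$ has subexponential growth if $\mu_\infty(M)=\limsup_{R\to\infty}\frac1R\log\mathrm{vol}(B_R(q_0))=0$,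 where $q_0\in M$ and $B_R(q_0)$ is the geodesic ball. *)

theory Defs
  imports "HOL-Analysis.Analysis"
begin

section \<open>The total space and its projection to the projective line\<close>

definition eh_rel :: "complex \<times> complex \<times> complex \<Rightarrow> complex \<times> complex \<times> complex \<Rightarrow> bool" where
  "eh_rel = (\<lambda>(a, b, g) (a', b', g').
     (a, b) \<noteq> (0, 0) \<and> (\<exists>A. A \<noteq> 0 \<and> a' = A * a \<and> b' = A * b \<and> g' = g / A\<^sup>2))"

lemma part_equivp_eh_rel: "part_equivp eh_rel"
proof (rule part_equivpI)
  have "eh_rel (1, 1, 1) (1, 1, 1)"
    by (auto simp: eh_rel_def intro!: exI[of _ 1])
  then show "\<exists>x. eh_rel x x" by blast
next
  show "symp eh_rel"
  proof (rule sympI)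
    fix x y assume "eh_rel x y"
    then obtain a b g A where *: "x = (a, b, g)" "y = (A * a, A * b, g / A\<^sup>2)"
        "A \<noteq> 0" "(a, b) \<noteq> (0, 0)"
      by (cases x; cases y) (auto simp: eh_rel_def)
    then show "eh_rel y x"
      by (auto simp: eh_rel_def field_simps intro!: exI[of _ "inverse A"])
  qed
next
  show "transp eh_rel"
  proof (rule transpI)
    fix x y z assume xy: "eh_rel x y" and yz: "eh_rel y z"
    from xy obtain a b g A where x: "x = (a, b, g)" and y: "y = (A * a, A * b, g / A\<^sup>2)"
        and A: "A \<noteq> 0" and ab: "(a, b) \<noteq> (0, 0)"
      by (cases x; cases y) (auto simp: eh_rel_def)
    from yz y obtain B where z: "z = (B * (A * a), B * (A * b), g / A\<^sup>2 / B\<^sup>2)" and B: "B \<noteq> 0"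
      by (cases z) (auto simp: eh_rel_def)
    show "eh_rel x z"
      unfolding x z eh_rel_def using A B ab
      by (auto simp: power_mult_distrib mult.assoc mult.commute intro!: exI[of _ "B * A"])
  qed
qed

quotient_type H2 = "complex \<times> complex \<times> complex" / partial: eh_rel
  by (rule part_equivp_eh_rel)

text \<open>The class of a triple; only meaningful if the first two entries do not both vanish.\<close>

definition H2_class :: "complex \<Rightarrow> complex \<Rightarrow> complex \<Rightarrow> H2" where
  "H2_class a b g = abs_H2 (a, b, g)"

text \<open>The projective line is \<^typ>\<open>complex option\<close>, with \<^const>\<open>None\<close> as the point at infinity.\<close>

lift_definition H2_proj :: "H2 \<Rightarrow> complex option" is
  "\<lambda>(a, b, g). if b = 0 then None else Some (a / b)"
  by (auto simp: eh_rel_def)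

text \<open>
  Both \<open>P\<^sup>1\<close> and \<open>H\<^sup>2\<close> are covered by two holomorphic charts, the second one being centred at (the
  fibre over) infinity. In both charts of \<open>H\<^sup>2\<close> the first coordinate is that of the base
  point, and the second one is linear on the fibres.
\<close>

datatype chart = Affine | Infinity

fun P1_dom :: "chart \<Rightarrow> complex option set" where
  "P1_dom Affine = {q. q \<noteq> None}"
| "P1_dom Infinity = {q. q \<noteq> Some 0}"

fun P1_coord :: "chart \<Rightarrow> complex option \<Rightarrow> complex" where
  "P1_coord Affine q = the q"
| "P1_coord Infinity q = (case q of None \<Rightarrow> 0 | Some z \<Rightarrow> inverse z)"

definition H2_dom :: "chart \<Rightarrow> H2 set" where
  "H2_dom i = {x. H2_proj x \<in> P1_dom i}"

lift_definition H2_coord_Affine :: "H2 \<Rightarrow> complex^2" is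
  "\<lambda>(a, b, g). vector [a / b, g * b\<^sup>2]"
  by (auto simp: eh_rel_def power_mult_distrib)

lift_definition H2_coord_Infinity :: "H2 \<Rightarrow> complex^2" is
  "\<lambda>(a, b, g). vector [b / a, g * a\<^sup>2]"
  by (auto simp: eh_rel_def power_mult_distrib)

fun H2_coord :: "chart \<Rightarrow> H2 \<Rightarrow> complex^2" where
  "H2_coord Affine = H2_coord_Affine"
| "H2_coord Infinity = H2_coord_Infinity"

fun H2_point :: "chart \<Rightarrow> complex^2 \<Rightarrow> H2" where
  "H2_point Affine p = H2_class (p$1) 1 (p$2)"
| "H2_point Infinity p = H2_class 1 (p$1) (p$2)"

definition chart_at :: "complex option \<Rightarrow> chart" where
  "chart_at q = (if q = None then Infinity else Affine)"

lemma H2_proj_class: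
  "(a, b) \<noteq> (0, 0) \<Longrightarrow> H2_proj (H2_class a b g) = (if b = 0 then None else Some (a / b))"
  unfolding H2_class_def
  by (subst H2_proj.abs_eq) (auto simp: eh_rel_def intro!: exI[of _ 1])

lemma H2_coord_class:
  assumes "(a, b) \<noteq> (0, 0)"
  shows "H2_coord Affine (H2_class a b g) = vector [a / b, g * b\<^sup>2]"
    and "H2_coord Infinity (H2_class a b g) = vector [b / a, g * a\<^sup>2]"
proof -
  have *: "eh_rel (a, b, g) (a, b, g)"
    using assms by (auto simp: eh_rel_def intro!: exI[of _ 1])
  show "H2_coord Affine (H2_class a b g) = vector [a / b, g * b\<^sup>2]"
    using H2_coord_Affine.abs_eq[OF *] by (simp add: H2_class_def)
  show "H2_coord Infinity (H2_class a b g) = vector [b / a, g * a\<^sup>2]"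
    using H2_coord_Infinity.abs_eq[OF *] by (simp add: H2_class_def)
qed

lemma H2_coord_point: "H2_coord i (H2_point i p) = p"
  by (cases i) (auto simp: H2_coord_class vec_eq_iff forall_2 simp del: H2_coord.simps)

lemma H2_point_in_dom: "H2_point i p \<in> H2_dom i"
  by (cases i) (auto simp: H2_dom_def H2_proj_class)

section \<open>The Eguchi-Hanson metric\<close>

lift_definition eh_u1 :: "H2 \<Rightarrow> real" is
  "\<lambda>(a, b, g). (cmod (a * csqrt g))\<^sup>2 + (cmod (b * csqrt g))\<^sup>2"
proof -
  have n: "(cmod (x * csqrt g))\<^sup>2 = (cmod x)\<^sup>2 * cmod g" for x g
    by (simp add: norm_mult power_mult_distrib flip: norm_power)
  show "(case p of (a, b, g) \<Rightarrow> (cmod (a * csqrt g))\<^sup>2 + (cmod (b * csqrt g))\<^sup>2) =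
        (case q of (a, b, g) \<Rightarrow> (cmod (a * csqrt g))\<^sup>2 + (cmod (b * csqrt g))\<^sup>2)"
    if "eh_rel p q" for p q
    using that
    by (auto simp: eh_rel_def n norm_mult norm_divide norm_power power_mult_distrib field_simps)
qed

definition eh_f :: "real \<Rightarrow> H2 \<Rightarrow> real" where
  "eh_f t x = sqrt ((eh_u1 x)\<^sup>2 + t^4) + t\<^sup>2 * ln (eh_u1 x / (sqrt ((eh_u1 x)\<^sup>2 + t^4) + t\<^sup>2))"

text \<open>The Wirtinger derivatives with respect to \<open>z\<^sub>j\<close> and its conjugate.\<close>

definition wirtinger :: "2 \<Rightarrow> (complex^2 \<Rightarrow> complex) \<Rightarrow> complex^2 \<Rightarrow> complex" where
  "wirtinger j F p =
     (frechet_derivative F (at p) (axis j 1) - \<i> * frechet_derivative F (at p) (axis j \<i>)) / 2"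

definition wirtinger_bar :: "2 \<Rightarrow> (complex^2 \<Rightarrow> complex) \<Rightarrow> complex^2 \<Rightarrow> complex" where
  "wirtinger_bar j F p =
     (frechet_derivative F (at p) (axis j 1) + \<i> * frechet_derivative F (at p) (axis j \<i>)) / 2"

text \<open>
  The coefficients of \<open>\<partial>\<partial>\<close>-bar of the potential in a chart. The zero section is \<open>p $ 2 = 0\<close>, where the
  potential is singular; there the coefficients are those of the continuous extension of the form.
\<close>

definition eh_levi :: "real \<Rightarrow> chart \<Rightarrow> 2 \<Rightarrow> 2 \<Rightarrow> complex^2 \<Rightarrow> complex" where
  "eh_levi t i j k = wirtinger j (wirtinger_bar k (\<lambda>p. of_real (eh_f t (H2_point i p))))"

definition eh_coeff :: "real \<Rightarrow> chart \<Rightarrow> 2 \<Rightarrow> 2 \<Rightarrow> complex^2 \<Rightarrow> complex" where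
  "eh_coeff t i j k p =
     (if p$2 \<noteq> 0 then eh_levi t i j k p
      else Lim (at p within {q. q$2 \<noteq> 0}) (eh_levi t i j k))"

text \<open>
  The forms below are evaluated at the point with coordinates \<open>p\<close> in chart \<open>i\<close>, on tangent vectors
  given by their components in that chart; \<open>J\<close> is multiplication by \<open>\<i>\<close>.
\<close>

definition eh_omega :: "real \<Rightarrow> chart \<Rightarrow> complex^2 \<Rightarrow> complex^2 \<Rightarrow> complex^2 \<Rightarrow> real" where
  "eh_omega t i p X Y =
     Re (\<i> * (\<Sum>j\<in>UNIV. \<Sum>k\<in>UNIV. eh_coeff t i j k p * (X$j * cnj (Y$k) - Y$j * cnj (X$k))))"

definition eh_metric :: "real \<Rightarrow> chart \<Rightarrow> complex^2 \<Rightarrow> complex^2 \<Rightarrow> complex^2 \<Rightarrow> real" where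
  "eh_metric t i p X Y = eh_omega t i p X (\<i> *s Y)"

section \<open>The preimage of a curve: induced distance and volume\<close>

text \<open>A curve in the projective line is given by a parametrisation of period 1.\<close>

definition M3 :: "(real \<Rightarrow> complex option) \<Rightarrow> H2 set" where
  "M3 \<kappa> = {x. H2_proj x \<in> range \<kappa>}"

definition H2_path :: "(real \<Rightarrow> H2) \<Rightarrow> bool" where
  "H2_path x \<longleftrightarrow>
     (\<forall>s\<in>{0..1}. \<exists>i. \<exists>e>0.
        x ` (cball s e \<inter> {0..1}) \<subseteq> H2_dom i \<and>
        (H2_coord i \<circ> x) piecewise_C1_differentiable_on (cball s e \<inter> {0..1}))"

definition eh_speed :: "real \<Rightarrow> (real \<Rightarrow> H2) \<Rightarrow> real \<Rightarrow> real" where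
  "eh_speed t x s =
     (let i = chart_at (H2_proj (x s)); V = vector_derivative (H2_coord i \<circ> x) (at s)
      in sqrt (eh_metric t i (H2_coord i (x s)) V V))"

definition eh_length :: "real \<Rightarrow> (real \<Rightarrow> H2) \<Rightarrow> ennreal" where
  "eh_length t x = (\<integral>\<^sup>+ s\<in>{0..1}. ennreal (eh_speed t x s) \<partial>lborel)"

definition M3_dist :: "real \<Rightarrow> (real \<Rightarrow> complex option) \<Rightarrow> H2 \<Rightarrow> H2 \<Rightarrow> ennreal" where
  "M3_dist t \<kappa> q q' =
     (INF x\<in>{x. H2_path x \<and> x ` {0..1} \<subseteq> M3 \<kappa> \<and> x 0 = q \<and> x 1 = q'}. eh_length t x)"

definition M3_ball :: "real \<Rightarrow> (real \<Rightarrow> complex option) \<Rightarrow> H2 \<Rightarrow> real \<Rightarrow> H2 set" where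
  "M3_ball t \<kappa> q R = {x \<in> M3 \<kappa>. M3_dist t \<kappa> q x < ennreal R}"

text \<open>
  \<open>M\<^sup>3\<close> is parametrised by \<open>(s, w)\<close>, where \<open>w\<close> is the fibre coordinate over \<open>\<kappa> s\<close>. The volume element
  is the square root of the Gram determinant of the coordinate vectors belonging to \<open>s\<close>,
  \<open>Re w\<close> and \<open>Im w\<close>, all computed in the chart selected by \<open>\<kappa> s\<close>. For a simple closed curve this
  parametrisation is a bijection from \<open>{0..<1} \<times> \<complex>\<close> onto \<open>M\<^sup>3\<close>; otherwise overlapping parts of
  \<open>M\<^sup>3\<close> are counted with multiplicity.
\<close>

definition M3_coord :: "(real \<Rightarrow> complex option) \<Rightarrow> real \<Rightarrow> complex \<Rightarrow> complex^2" where
  "M3_coord \<kappa> s w = vector [P1_coord (chart_at (\<kappa> s)) (\<kappa> s), w]"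

definition M3_frame :: "(real \<Rightarrow> complex option) \<Rightarrow> real \<Rightarrow> (complex^2)^3" where
  "M3_frame \<kappa> s =
     vector [vector [vector_derivative (P1_coord (chart_at (\<kappa> s)) \<circ> \<kappa>) (at s), 0],
             vector [0, 1], vector [0, \<i>]]"

definition M3_density :: "real \<Rightarrow> (real \<Rightarrow> complex option) \<Rightarrow> real \<Rightarrow> complex \<Rightarrow> real" where
  "M3_density t \<kappa> s w =
     sqrt (det (\<chi> m n. eh_metric t (chart_at (\<kappa> s)) (M3_coord \<kappa> s w)
                         (M3_frame \<kappa> s $ m) (M3_frame \<kappa> s $ n) :: real^3^3))"

definition M3_vol :: "real \<Rightarrow> (real \<Rightarrow> complex option) \<Rightarrow> H2 set \<Rightarrow> ennreal" where
  "M3_vol t \<kappa> B =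
     (\<integral>\<^sup>+ (s, w)\<in>{(s, w). 0 \<le> s \<and> s < 1 \<and> H2_point (chart_at (\<kappa> s)) (M3_coord \<kappa> s w) \<in> B}.
        ennreal (M3_density t \<kappa> s w) \<partial>(lborel :: (real \<times> complex) measure))"

section \<open>Volume growth\<close>

definition ennreal_log :: "ennreal \<Rightarrow> ereal" where
  "ennreal_log v = (if v = 0 then - \<infinity> else if v = \<infinity> then \<infinity> else ereal (ln (enn2real v)))"

definition M3_growth :: "real \<Rightarrow> (real \<Rightarrow> complex option) \<Rightarrow> H2 \<Rightarrow> ereal" where
  "M3_growth t \<kappa> q =
     Limsup at_top (\<lambda>R::real. ereal (1 / R) * ennreal_log (M3_vol t \<kappa> (M3_ball t \<kappa> q R)))"

definition M3_subexponential_growth :: "real \<Rightarrow> (real \<Rightarrow> complex option) \<Rightarrow> bool" where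
  "M3_subexponential_growth t \<kappa> \<longleftrightarrow> (\<forall>q\<in>M3 \<kappa>. M3_growth t \<kappa> q = 0)"

section \<open>Closed curves and Moebius transforms\<close>

text \<open>Smooth, regular and of period 1; self-intersections are not excluded.\<close>

definition smooth_closed_curve :: "(real \<Rightarrow> complex) \<Rightarrow> bool" where
  "smooth_closed_curve c \<longleftrightarrow>
     (\<forall>n s. ((\<lambda>h u. vector_derivative h (at u)) ^^ n) c differentiable (at s)) \<and>
     (\<forall>s. vector_derivative c (at s) \<noteq> 0) \<and>
     (\<forall>s. c (s + 1) = c s)"

definition unitary_group2 :: "(complex^2^2) set" where
  "unitary_group2 =
     {A. A ** (\<chi> j k. cnj (A$k$j)) = mat 1 \<and> (\<chi> j k. cnj (A$k$j)) ** A = mat 1}"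

definition P1_moebius :: "complex^2^2 \<Rightarrow> complex option \<Rightarrow> complex option" where
  "P1_moebius A q = (case q of
       None \<Rightarrow> if A$2$1 = 0 then None else Some (A$1$1 / A$2$1)
     | Some z \<Rightarrow> if A$2$1 * z + A$2$2 = 0 then None
                 else Some ((A$1$1 * z + A$1$2) / (A$2$1 * z + A$2$2)))"

end

theory Submission
  imports Defs
begin

text \<open>
  In a chart with coordinates \<open>(z, w)\<close> put \<open>N = 1 + |z|\<^sup>2\<close>, \<open>S = sqrt (|w|\<^sup>2 N\<^sup>2 + t\<^sup>4)\<close> and let
  \<open>\<theta>(X) = N X\<^sub>2 / 2 + w cnj(z) X\<^sub>1\<close>. As \<open>u\<^sub>1 = |w| N\<close> and \<open>u\<^sub>1 f\<^sub>t'(u\<^sub>1) = S\<close>, differentiating the potential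
  gives \<open>|X|\<^sup>2 = 2 (S |X\<^sub>1|\<^sup>2 / N\<^sup>2 + |\<theta>(X)|\<^sup>2 / S)\<close>, which also extends across \<open>w = 0\<close>. Since
  \<open>|dS(X)| \<le> 2 |\<theta>(X)|\<close>, the function \<open>sqrt S\<close> is 1-Lipschitz, so a ball of radius \<open>R\<close> lies in
  \<open>u\<^sub>1 \<le> (const + R)\<^sup>2\<close>. The volume density over a curve with spherical speed \<open>\<sigma>\<close> is \<open>\<sigma> N\<^sup>2 / sqrt (2 S)\<close>, and
  the disc \<open>|w| N \<le> r\<close> has area \<open>\<pi> r\<^sup>2 / N\<^sup>2\<close>, so the volume is at most a polynomial in \<open>R\<close>. It is also
  bounded away from 0 for large \<open>R\<close>, because the part of \<open>M\<^sup>3\<close> with \<open>u\<^sub>1 \<le> 1\<close> has positive volume and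
  bounded distance from the base point.

  A Moebius image of a curve has a global lift to homogeneous coordinates, in which the length of
  tangent vectors and the spherical speed have the same expression near infinity as elsewhere.
\<close>

section \<open>The metric in coordinates\<close>

definition eh_N :: "complex^2 \<Rightarrow> real" where
  "eh_N p = 1 + (cmod (p$1))\<^sup>2"

definition eh_S :: "real \<Rightarrow> complex^2 \<Rightarrow> real" where
  "eh_S t p = sqrt ((cmod (p$2))\<^sup>2 * (eh_N p)\<^sup>2 + t^4)"

lemma eh_N_ge_1: "eh_N p \<ge> 1"
  by (simp add: eh_N_def)

lemma eh_S_pos: "t > 0 \<Longrightarrow> eh_S t p > 0"
  unfolding eh_S_def by (intro real_sqrt_gt_zero add_nonneg_pos) auto

lemma eh_rel_refl: "(a, b) \<noteq> (0, 0) \<Longrightarrow> eh_rel (a, b, g) (a, b, g)"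
  by (auto simp: eh_rel_def intro!: exI[of _ 1])

lemma eh_u1_class:
  assumes "(a, b) \<noteq> (0, 0)"
  shows "eh_u1 (H2_class a b g) = cmod g * ((cmod a)\<^sup>2 + (cmod b)\<^sup>2)"
  unfolding H2_class_def using eh_u1.abs_eq[OF eh_rel_refl[OF assms]]
  by (simp add: norm_mult power_mult_distrib algebra_simps flip: norm_power)

lemma eh_u1_point: "eh_u1 (H2_point i p) = cmod (p$2) * eh_N p"
  by (cases i) (simp_all add: eh_u1_class eh_N_def add.commute)

text \<open>A common factor of the first two homogeneous coordinates is traded for its square on the
  fibre coordinate. This passes between a lift and the representatives normalised by a
  chart.\<close>

lemma H2_class_scale:
  assumes "(a, b) \<noteq> (0, 0)" "l \<noteq> 0"
  shows "H2_class (l * a) (l * b) g = H2_class a b (g * l\<^sup>2)"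
proof -
  have "eh_rel (a, b, g * l\<^sup>2) (l * a, l * b, g)"
    using assms by (auto simp: eh_rel_def intro!: exI[of _ l])
  then show ?thesis
    by (metis H2_class_def Quotient3_H2 Quotient3_rel_abs)
qed

section \<open>Real derivatives of \<open>eh_N\<close>, \<open>eh_S\<close> and the
  potential\<close>

lemma has_derivative_nth [derivative_intros]:
  "((\<lambda>p::complex^2. p $ j) has_derivative (\<lambda>h. h $ j)) F"
  by (rule bounded_linear_imp_has_derivative) (rule bounded_linear_vec_nth)

lemma has_derivative_cmod_nth_sq:
  "((\<lambda>p::complex^2. (cmod (p$j))\<^sup>2) has_derivative (\<lambda>h. 2 * Re (cnj (p$j) * h$j))) (at p)"
  unfolding cmod_power2
  by (rule derivative_eq_intros refl | simp add: algebra_simps)+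

lemma has_derivative_eh_N:
  "(eh_N has_derivative (\<lambda>h. 2 * Re (cnj (p$1) * h$1))) (at p)"
  using has_derivative_add[OF has_derivative_const[of 1] has_derivative_cmod_nth_sq[of 1 p]]
  by (simp add: eh_N_def[abs_def])

lemma has_derivative_eh_S:
  assumes "t > 0"
  shows "(eh_S t has_derivative
    (\<lambda>h. ((eh_N p)\<^sup>2 * Re (cnj (p$2) * h$2) + 2 * (cmod (p$2))\<^sup>2 * eh_N p * Re (cnj (p$1) * h$1)) / eh_S t p))
    (at p)"
proof -
  define U where "U = (\<lambda>p::complex^2. (cmod (p$2))\<^sup>2 * (eh_N p)\<^sup>2 + t^4)"
  have pos: "0 < U p"
    using assms unfolding U_def by (intro add_nonneg_pos) auto
  have S: "eh_S t = (\<lambda>p. sqrt (U p))"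
    by (simp add: eh_S_def U_def fun_eq_iff)
  have U': "(U has_derivative (\<lambda>h. 2 * ((eh_N p)\<^sup>2 * Re (cnj (p$2) * h$2) +
      2 * (cmod (p$2))\<^sup>2 * eh_N p * Re (cnj (p$1) * h$1)))) (at p)"
    unfolding U_def
    by (rule has_derivative_eq_rhs[OF has_derivative_add[OF has_derivative_mult[OF
          has_derivative_cmod_nth_sq has_derivative_power[OF has_derivative_eh_N]] has_derivative_const]])
       (simp add: fun_eq_iff algebra_simps del: times_complex.sel)
  have aux: "2 * a * (inverse s / 2) = a / s" for a s :: real
    by (simp add: field_simps)
  have "((\<lambda>p. sqrt (U p)) has_derivative (\<lambda>h. 2 * ((eh_N p)\<^sup>2 * Re (cnj (p$2) * h$2) +
      2 * (cmod (p$2))\<^sup>2 * eh_N p * Re (cnj (p$1) * h$1)) * (inverse (sqrt (U p)) / 2))) (at p)"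
    by (rule DERIV_compose_FDERIV[where f = sqrt and g = U, OF DERIV_real_sqrt[OF pos] U'])
  then show ?thesis
    unfolding S
    by (rule has_derivative_eq_rhs) (rule ext, rule aux)
qed

lemma continuous_on_eh_S: "t > 0 \<Longrightarrow> continuous_on UNIV (eh_S t)"
proof (rule continuous_at_imp_continuous_on, rule ballI)
  fix p assume "t > 0"
  from has_derivative_continuous[OF has_derivative_eh_S[OF this]]
  show "isCont (eh_S t) p" .
qed

text \<open>For \<open>p$2 \<noteq> 0\<close> this is the differential of \<open>ln u\<close> at
  \<open>p\<close>, where \<open>u = cmod (p$2) * eh_N p\<close> is the function
  \<open>eh_u1\<close> in a chart.\<close>

definition eh_L :: "complex^2 \<Rightarrow> complex^2 \<Rightarrow> real" where
  "eh_L p h = Re (cnj (p$2) * h$2) / (cmod (p$2))\<^sup>2 + 2 * Re (cnj (p$1) * h$1) / eh_N p"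

lemma eh_S_sq: "t > 0 \<Longrightarrow> (eh_S t p)\<^sup>2 = (cmod (p$2))\<^sup>2 * (eh_N p)\<^sup>2 + t^4"
  unfolding eh_S_def by (rule real_sqrt_pow2) (intro add_nonneg_nonneg; simp)

lemma eh_N_pos: "eh_N p > 0" and eh_N_nz [simp]: "eh_N p \<noteq> 0"
  using eh_N_ge_1[of p] by auto

text \<open>Since \<open>S^2 - t^4 = u^2\<close>, the differential \<open>u du / S\<close> of
  \<open>S\<close> is \<open>u^2 / S\<close> times that of \<open>ln u\<close>.\<close>

lemma has_derivative_eh_S_log:
  assumes "t > 0" "p$2 \<noteq> 0"
  shows "(eh_S t has_derivative (\<lambda>h. ((eh_S t p)\<^sup>2 - t^4) / eh_S t p * eh_L p h)) (at p)"
proof (rule has_derivative_eq_rhs[OF has_derivative_eh_S[OF assms(1)]], rule ext)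
  fix h
  have "n\<^sup>2 * a + 2 * m * n * b = m * n\<^sup>2 * (a / m + 2 * b / n)" if "m \<noteq> 0" "n \<noteq> 0" for m n a b :: real
    using that by (simp add: field_simps power2_eq_square)
  then show "((eh_N p)\<^sup>2 * Re (cnj (p$2) * h$2) + 2 * (cmod (p$2))\<^sup>2 * eh_N p * Re (cnj (p$1) * h$1)) / eh_S t p
      = ((eh_S t p)\<^sup>2 - t^4) / eh_S t p * eh_L p h"
    using assms by (simp add: eh_S_sq eh_L_def del: times_complex.sel)
qed

text \<open>The logarithm is split into summands that are differentiated separately;
  \<open>ln |w|\<close> appears as half of \<open>ln |w|^2\<close>, whose argument has a simple
  derivative.\<close>

lemma eh_f_point:
  assumes "t > 0" "p$2 \<noteq> 0"
  shows "eh_f t (H2_point i p) =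
    eh_S t p + t\<^sup>2 * (ln ((cmod (p$2))\<^sup>2) / 2 + ln (eh_N p) - ln (eh_S t p + t\<^sup>2))"
proof -
  have "eh_S t p + t\<^sup>2 > 0" using eh_S_pos[OF assms(1), of p] assms(1) by (simp add: add_pos_pos)
  then have "ln (cmod (p$2) * eh_N p / (eh_S t p + t\<^sup>2)) =
      ln ((cmod (p$2))\<^sup>2) / 2 + ln (eh_N p) - ln (eh_S t p + t\<^sup>2)"
    using assms eh_N_pos[of p] by (simp add: ln_div ln_mult ln_realpow)
  then show ?thesis
    by (simp add: eh_f_def eh_u1_point eh_S_def power_mult_distrib)
qed

lemma has_derivative_ln_compose:
  fixes g :: "'a::real_normed_vector \<Rightarrow> real"
  assumes "(g has_derivative g') (at x within s)" "g x > 0"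
  shows "((\<lambda>x. ln (g x)) has_derivative (\<lambda>h. g' h / g x)) (at x within s)"
  using DERIV_compose_FDERIV[where f = ln and g = g, OF DERIV_ln[OF assms(2)] assms(1)]
  by (simp add: divide_inverse)

text \<open>This is \<open>u f'(u) = S\<close>: the logarithmic correction and \<open>dS\<close>
  combine to \<open>S\<close> times the differential of \<open>ln u\<close>.\<close>

lemma has_derivative_eh_f:
  assumes t: "t > 0" and p: "p$2 \<noteq> 0"
  shows "((\<lambda>p. eh_f t (H2_point i p)) has_derivative (\<lambda>h. eh_S t p * eh_L p h)) (at p)"
proof -
  note S = has_derivative_eh_S_log[OF t p]
  have pos: "eh_S t p + t\<^sup>2 > 0"
    using eh_S_pos[OF assms(1), of p] assms(1) by (simp add: add_pos_pos)
  have 1: "((\<lambda>p. ln ((cmod (p$2))\<^sup>2) / 2) has_derivative (\<lambda>h. Re (cnj (p$2) * h$2) / (cmod (p$2))\<^sup>2)) (at p)"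
    using has_derivative_divide'[OF has_derivative_ln_compose[OF has_derivative_cmod_nth_sq[of 2 p]] has_derivative_const[of 2]] p
    by (simp del: times_complex.sel)
  have 2: "((\<lambda>p. ln (eh_N p)) has_derivative (\<lambda>h. 2 * Re (cnj (p$1) * h$1) / eh_N p)) (at p)"
    by (rule has_derivative_ln_compose[OF has_derivative_eh_N eh_N_pos])
  have 3: "((\<lambda>p. ln (eh_S t p + t\<^sup>2)) has_derivative
      (\<lambda>h. (((eh_S t p)\<^sup>2 - t^4) / eh_S t p * eh_L p h) / (eh_S t p + t\<^sup>2))) (at p)"
    using has_derivative_ln_compose[OF has_derivative_add[OF S has_derivative_const[of "t\<^sup>2"]]] pos by simp
  have 4: "((\<lambda>p. ln ((cmod (p$2))\<^sup>2) / 2 + ln (eh_N p)) has_derivative eh_L p) (at p)"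
    using has_derivative_add[OF 1 2] by (simp add: eh_L_def[abs_def])
  have 5: "((\<lambda>p. eh_S t p + t\<^sup>2 * (ln ((cmod (p$2))\<^sup>2) / 2 + ln (eh_N p) - ln (eh_S t p + t\<^sup>2)))
     has_derivative (\<lambda>h. ((eh_S t p)\<^sup>2 - t^4) / eh_S t p * eh_L p h + t\<^sup>2 * (eh_L p h -
         (((eh_S t p)\<^sup>2 - t^4) / eh_S t p * eh_L p h) / (eh_S t p + t\<^sup>2)))) (at p)"
    by (rule has_derivative_add[OF S has_derivative_mult_right[OF has_derivative_diff[OF 4 3]]])
  \<comment> \<open>Used with \<open>a = S\<close> and \<open>b = t^2\<close>; the factor
    \<open>a + b\<close> of \<open>S^2 - t^4\<close> cancels the denominator coming from the last
    logarithm.\<close>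
  have aux: "(a - b) * (a + b) / a * l + b * (l - (a - b) * (a + b) / a * l / (a + b)) = a * l"
    if "a > 0" "a + b > 0" for a b l :: real
  proof -
    have *: "(a - b) * (a + b) / a * l / (a + b) = (a - b) / a * l"
      using that by simp
    show ?thesis
      unfolding * using that by (simp add: field_simps)
  qed
  have "(eh_S t p)\<^sup>2 - t^4 = (eh_S t p - t\<^sup>2) * (eh_S t p + t\<^sup>2)"
    by (simp add: algebra_simps power2_eq_square power4_eq_xxxx)
  then have "((eh_S t p)\<^sup>2 - t^4) / eh_S t p * L + t\<^sup>2 * (L - (((eh_S t p)\<^sup>2 - t^4) / eh_S t p * L) / (eh_S t p + t\<^sup>2))
     = eh_S t p * L" for L
    using aux[OF eh_S_pos[OF t, of p] pos, of L] by simp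
  with 5 have 6: "((\<lambda>p. eh_S t p + t\<^sup>2 * (ln ((cmod (p$2))\<^sup>2) / 2 + ln (eh_N p) - ln (eh_S t p + t\<^sup>2)))
     has_derivative (\<lambda>h. eh_S t p * eh_L p h)) (at p)"
    by simp
  have "open {q::complex^2. q$2 \<noteq> 0}"
    by (intro open_Collect_neq continuous_intros)
  from has_derivative_transform_within_open[OF 6 this] show ?thesis
    using p eh_f_point[OF t] by auto
qed

section \<open>The Levi form of the potential and its extension across the zero section\<close>

lemma wirtinger_eq:
  assumes "(F has_derivative F') (at p)"
  shows "wirtinger j F p = (F' (axis j 1) - \<i> * F' (axis j \<i>)) / 2"
    and "wirtinger_bar j F p = (F' (axis j 1) + \<i> * F' (axis j \<i>)) / 2"
  using frechet_derivative_at[OF assms] by (auto simp: wirtinger_def wirtinger_bar_def)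

text \<open>The derivatives of the potential by the conjugate variables: \<open>S\<close> times
  those of \<open>ln u\<close>, which are \<open>z / N\<close> and
  \<open>1 / (2 * cnj w)\<close>.\<close>

definition eh_grad :: "real \<Rightarrow> 2 \<Rightarrow> complex^2 \<Rightarrow> complex" where
  "eh_grad t k p = of_real (eh_S t p) * (if k = 1 then p$1 * of_real (1 / eh_N p) else inverse (2 * cnj (p$2)))"

lemma wirtinger_bar_eh_f:
  assumes t: "t > 0" and p: "p$2 \<noteq> 0"
  shows "wirtinger_bar k (\<lambda>p. of_real (eh_f t (H2_point i p))) p = eh_grad t k p"
proof -
  have "inverse (2 * cnj (p$2)) = p$2 / (2 * of_real ((cmod (p$2))\<^sup>2))"
    using p by (simp add: field_simps complex_norm_square del: of_real_power)
  then show ?thesis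
  unfolding wirtinger_eq(2)[OF has_derivative_of_real[OF has_derivative_eh_f[OF t p]]] eh_L_def eh_grad_def
  using exhaust_2[of k]
  by (auto simp: axis_def complex_eq_iff)
qed

text \<open>The Levi matrix in closed form. No entry has \<open>p$2\<close> in a denominator, so it
  makes sense and is continuous on the zero section too.\<close>

definition eh_H :: "real \<Rightarrow> 2 \<Rightarrow> 2 \<Rightarrow> complex^2 \<Rightarrow> complex" where
  "eh_H t j k p =
    (if j = 1 then
       if k = 1 then of_real (eh_S t p / (eh_N p)\<^sup>2 + (cmod (p$1))\<^sup>2 * (cmod (p$2))\<^sup>2 / eh_S t p)
       else of_real (eh_N p / (2 * eh_S t p)) * (cnj (p$1) * p$2)
     else
       if k = 1 then of_real (eh_N p / (2 * eh_S t p)) * (cnj (p$2) * p$1)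
       else of_real ((eh_N p)\<^sup>2 / (4 * eh_S t p)))"

lemma has_derivative_eh_grad:
  assumes t: "t > 0" and p: "p$2 \<noteq> 0"
  shows "(eh_grad t k has_derivative (\<lambda>h. if k = 1 then
      of_real (eh_S t p) * (p$1 * of_real (- (2 * Re (cnj (p$1) * h$1)) / (eh_N p)\<^sup>2) + h$1 * of_real (1 / eh_N p))
        + of_real (((eh_S t p)\<^sup>2 - t^4) / eh_S t p * eh_L p h) * (p$1 * of_real (1 / eh_N p))
      else of_real (eh_S t p) * (- (2 * cnj (h$2) * (inverse (2 * cnj (p$2)))\<^sup>2))
        + of_real (((eh_S t p)\<^sup>2 - t^4) / eh_S t p * eh_L p h) * inverse (2 * cnj (p$2)))) (at p)"
proof -
  note S = has_derivative_of_real[OF has_derivative_eh_S_log[OF t p]]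
  have 1: "((\<lambda>p. 1 / eh_N p) has_derivative (\<lambda>h. - (2 * Re (cnj (p$1) * h$1)) / (eh_N p)\<^sup>2)) (at p)"
    by (rule has_derivative_eq_rhs[OF has_derivative_divide[OF has_derivative_const has_derivative_eh_N]])
       (simp_all add: fun_eq_iff power2_eq_square field_simps del: times_complex.sel)
  have 2: "((\<lambda>p. p$1 * of_real (1 / eh_N p) :: complex) has_derivative
     (\<lambda>h. p$1 * of_real (- (2 * Re (cnj (p$1) * h$1)) / (eh_N p)\<^sup>2) + h$1 * of_real (1 / eh_N p))) (at p)"
    by (rule has_derivative_mult[OF has_derivative_nth has_derivative_of_real[OF 1]])
  have 3: "((\<lambda>p::complex^2. 2 * cnj (p$2)) has_derivative (\<lambda>h. 2 * cnj (h$2))) (at p)"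
    by (rule has_derivative_mult_right[OF bounded_linear.has_derivative[OF bounded_linear_cnj has_derivative_nth]])
  have 4: "((\<lambda>p::complex^2. inverse (2 * cnj (p$2))) has_derivative
      (\<lambda>h. - (2 * cnj (h$2) * (inverse (2 * cnj (p$2)))\<^sup>2))) (at p)"
    by (rule has_derivative_eq_rhs[OF Deriv.has_derivative_inverse[OF _ 3]])
       (use p in \<open>simp_all add: fun_eq_iff power2_eq_square\<close>)
  show ?thesis
    using has_derivative_mult[OF S 2] has_derivative_mult[OF S 4]
    by (cases "k = 1") (simp_all only: eh_grad_def[abs_def] simp_thms if_True if_False)
qed

text \<open>A holomorphic Wirtinger derivative is applied to \<open>eh_grad\<close>: a product rule
  in which the derivative of \<open>S\<close> is \<open>u^2 / S\<close> times that of
  \<open>ln u\<close>.\<close>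

lemma eh_levi_eq:
  assumes t: "t > 0" and p: "p$2 \<noteq> 0"
  shows "eh_levi t i j k p = eh_H t j k p"
proof -
  have S: "eh_S t p > 0" by (rule eh_S_pos[OF t])
  have o: "open {q::complex^2. q$2 \<noteq> 0}"
    by (intro open_Collect_neq continuous_intros)
  note D = wirtinger_eq(1)[OF has_derivative_transform_within_open[OF has_derivative_eh_grad[OF t p] o]]
  \<comment> \<open>Twice the holomorphic derivatives of \<open>ln u\<close> with respect to the two
    coordinates.\<close>
  have L: "eh_L p (axis 1 1) - \<i> * eh_L p (axis 1 \<i>) = 2 * cnj (p$1) / of_real (eh_N p)"
    "eh_L p (axis 2 1) - \<i> * eh_L p (axis 2 \<i>) = inverse (p$2)"
    using p by (auto simp: eh_L_def axis_def complex_eq_iff cmod_power2)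
  have levi: "eh_levi t i j k p = (F' (axis j 1) - \<i> * F' (axis j \<i>)) / 2"
    if "(eh_grad t k has_derivative F') (at p)" for F'
    unfolding eh_levi_def
    by (rule wirtinger_eq(1), rule has_derivative_transform_within_open[OF that o])
       (use p in \<open>auto simp: wirtinger_bar_eh_f[OF t]\<close>)
  have sq: "(eh_S t p)\<^sup>2 - t^4 = (cmod (p$2))\<^sup>2 * (eh_N p)\<^sup>2"
    using eh_S_sq[OF t, of p] by simp
  \<comment> \<open>The differential of \<open>S\<close> is kept opaque, so that simplification
    treats it as a single real-linear form.\<close>
  define l where "l = (\<lambda>h. ((eh_S t p)\<^sup>2 - t^4) / eh_S t p * eh_L p h)"
  have l_app: "((eh_S t p)\<^sup>2 - t^4) / eh_S t p * eh_L p h = l h" for h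
    by (simp add: l_def)
  have l: "of_real (l (axis j 1)) - \<i> * of_real (l (axis j \<i>)) =
      of_real ((cmod (p$2))\<^sup>2 * (eh_N p)\<^sup>2 / eh_S t p) *
        (if j = 1 then 2 * cnj (p$1) / of_real (eh_N p) else inverse (p$2))"
  proof -
    have "of_real (c * a) - \<i> * of_real (c * b) = of_real c * (of_real a - \<i> * of_real b)" for a b c :: real
      by (simp add: algebra_simps)
    from this[of "(cmod (p$2))\<^sup>2 * (eh_N p)\<^sup>2 / eh_S t p" "eh_L p (axis j 1)" "eh_L p (axis j \<i>)"]
    show ?thesis
      using L exhaust_2[of j] unfolding l_def sq by (cases "j = 1") (simp_all del: of_real_mult of_real_divide of_real_power)
  qed
  have nsq: "(of_real (cmod (p$i)))\<^sup>2 = p$i * cnj (p$i)" for i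
    using complex_norm_square[of "p$i"] by simp
  show ?thesis
  proof (cases "k = 1")
    case True
    have lv: "eh_levi t i j k p =
      (of_real (eh_S t p) * ((if j = 1 then 2 * of_real (1 / eh_N p - (cmod (p$1))\<^sup>2 / (eh_N p)\<^sup>2) else 0)) +
       (of_real (l (axis j 1)) - \<i> * of_real (l (axis j \<i>))) * (p$1 * of_real (1 / eh_N p))) / 2"
      using exhaust_2[of j] unfolding levi[OF has_derivative_eh_grad[OF t p]] l_app if_P[OF True] cmod_power2
      by (auto simp: axis_def algebra_simps complex_eq_iff power2_eq_square add_divide_distrib diff_divide_distrib)
    \<comment> \<open>The Fubini-Study coefficient, which arises as the derivative of
      \<open>z / N\<close> with respect to \<open>z\<close>.\<close>
    have n: "1 / eh_N p - (cmod (p$1))\<^sup>2 / (eh_N p)\<^sup>2 = 1 / (eh_N p)\<^sup>2"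
    proof -
      have "(cmod (p$1))\<^sup>2 = eh_N p - 1" by (simp add: eh_N_def)
      then show ?thesis by (simp only:) (simp add: field_simps power2_eq_square)
    qed
    show ?thesis
      using exhaust_2[of j] p S unfolding lv unfolding n l True
      by (auto simp: eh_H_def nsq power2_eq_square[of "of_real (eh_N p)"] field_simps)
  next
    case False
    \<comment> \<open>The factor \<open>1 / (2 * cnj w)\<close> is antiholomorphic, so only the
      derivative of \<open>S\<close> survives.\<close>
    have lv: "eh_levi t i j k p =
      (of_real (l (axis j 1)) - \<i> * of_real (l (axis j \<i>))) * inverse (2 * cnj (p$2)) / 2"
      using exhaust_2[of j] unfolding levi[OF has_derivative_eh_grad[OF t p]] l_app if_not_P[OF False]
      by (auto simp: axis_def algebra_simps add_divide_distrib diff_divide_distrib)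
    show ?thesis
      using exhaust_2[of j] p S False unfolding lv unfolding l
      by (auto simp: eh_H_def nsq power2_eq_square[of "of_real (eh_N p)"] field_simps)
  qed
qed

text \<open>On the zero section the coefficient is a limit of values of \<open>eh_H\<close>, which
  is continuous everywhere because \<open>S\<close> and \<open>N\<close> never vanish.\<close>

lemma eh_coeff_eq:
  assumes t: "t > 0"
  shows "eh_coeff t i j k p = eh_H t j k p"
proof (cases "p$2 = 0")
  case False
  then show ?thesis by (simp add: eh_coeff_def eh_levi_eq[OF t])
next
  case True
  have S: "eh_S t q \<noteq> 0" for q
    using eh_S_pos[OF t, of q] by simp
  have "continuous_on UNIV eh_N"
    unfolding eh_N_def[abs_def] by (intro continuous_intros)
  with continuous_on_eh_S[OF t] have "continuous_on UNIV (eh_H t j k)"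
    unfolding eh_H_def[abs_def]
    by (cases "j = 1"; cases "k = 1"; simp only: if_True if_False simp_thms)
       (intro continuous_intros; simp add: S)+
  then have "isCont (eh_H t j k) p"
    by (simp add: continuous_on_eq_continuous_at)
  then have "(eh_H t j k \<longlongrightarrow> eh_H t j k p) (at p within {q. q$2 \<noteq> 0})"
    by (meson isCont_def tendsto_within_subset subset_UNIV)
  then have "(eh_levi t i j k \<longlongrightarrow> eh_H t j k p) (at p within {q. q$2 \<noteq> 0})"
    by (rule Lim_transform_eventually) (auto simp: eventually_at_filter eh_levi_eq[OF t])
  \<comment> \<open>The limit determines the value of \<open>Lim\<close> only along a nontrivial
    filter, so the zero section must have dense complement near \<open>p\<close>.\<close>
  moreover have "at p within {q. q$2 \<noteq> 0} \<noteq> bot"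
  proof -
    have "p islimpt {q. q$2 \<noteq> 0}"
    proof (rule islimptI)
      fix T assume "p \<in> T" "open T"
      then obtain e where e: "e > 0" "ball p e \<subseteq> T"
        by (meson openE)
      \<comment> \<open>A shift by half the radius along the fibre leaves the zero section and stays
        inside the ball.\<close>
      define q where "q = p + axis 2 (of_real (e / 2))"
      have "q \<in> ball p e"
        using e(1) by (simp add: q_def dist_norm axis_def norm_vec_def L2_set_def sum_2)
      moreover have "q$2 \<noteq> 0" "q \<noteq> p"
        using e(1) True by (auto simp: q_def axis_def vec_eq_iff intro!: exI[of _ 2])
      ultimately show "\<exists>y\<in>{q. q$2 \<noteq> 0}. y \<in> T \<and> y \<noteq> p"
        using e(2) by auto
    qed
    then show ?thesis
      by (simp add: trivial_limit_within)
  qed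
  ultimately show ?thesis
    using True by (simp add: eh_coeff_def tendsto_Lim)
qed

text \<open>Completing the square in the Levi matrix: all terms with \<open>1 / S\<close> form a
  rank-one Hermitian form, and the base term \<open>S / N^2\<close> remains. The polarised version
  serves the off-diagonal entries of the Gram matrix.\<close>

lemma eh_metric_eq:
  assumes t: "t > 0"
  shows "eh_metric t i p X Y = 2 * Re (of_real (eh_S t p / (eh_N p)\<^sup>2) * (X$1 * cnj (Y$1)) +
     of_real (1 / eh_S t p) * ((of_real (eh_N p / 2) * X$2 + p$2 * cnj (p$1) * X$1) *
        cnj (of_real (eh_N p / 2) * Y$2 + p$2 * cnj (p$1) * Y$1)))"
proof -
  define A B M where "A = eh_S t p / (eh_N p)\<^sup>2" and "B = 1 / eh_S t p" and "M = eh_N p / 2"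
  have "eh_H t 1 1 p = of_real (A + ((Re (p$1))\<^sup>2 + (Im (p$1))\<^sup>2) * ((Re (p$2))\<^sup>2 + (Im (p$2))\<^sup>2) * B)"
      "eh_H t 1 2 p = of_real (M * B) * (cnj (p$1) * p$2)"
      "eh_H t 2 1 p = of_real (M * B) * (cnj (p$2) * p$1)"
      "eh_H t 2 2 p = of_real (M\<^sup>2 * B)"
    by (simp_all add: eh_H_def A_def B_def M_def power_divide cmod_power2)
  then show ?thesis
    unfolding eh_metric_def eh_omega_def eh_coeff_eq[OF t] sum_2 A_def[symmetric] B_def[symmetric] M_def[symmetric]
    by (simp add: algebra_simps power2_eq_square)
qed

text \<open>Up to the factor \<open>N / 2\<close> this is the covariant derivative of the fibre
  coordinate for the Chern connection of the fibre metric \<open>|w|^2 N^2\<close>.\<close>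

definition eh_theta :: "complex^2 \<Rightarrow> complex^2 \<Rightarrow> complex" where
  "eh_theta p X = of_real (eh_N p / 2) * X$2 + p$2 * cnj (p$1) * X$1"

lemma eh_metric_diag:
  assumes t: "t > 0"
  shows "eh_metric t i p X X =
    2 * (eh_S t p * (cmod (X$1) / eh_N p)\<^sup>2 + (cmod (eh_theta p X))\<^sup>2 / eh_S t p)"
  unfolding eh_metric_eq[OF t] eh_theta_def[symmetric] complex_norm_square[symmetric]
  by (simp add: power_divide)

section \<open>Tangent vectors in homogeneous coordinates\<close>

lemma has_vector_derivative_vec2:
  assumes "(f has_vector_derivative f') F" "(g has_vector_derivative g') F"
  shows "((\<lambda>x. vector [f x, g x] :: complex^2) has_vector_derivative vector [f', g']) F"
proof -
  have v: "vector [a, b] = (axis 1 a + axis 2 b :: complex^2)" for a b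
    by (simp add: vec_eq_iff forall_2 axis_def)
  have "bounded_linear (axis j :: complex \<Rightarrow> complex^2)" for j
    by (auto simp: linear_conv_bounded_linear[symmetric] axis_def vec_eq_iff intro!: linearI)
  from has_vector_derivative_add[OF bounded_linear.has_vector_derivative[OF this assms(1)]
      bounded_linear.has_vector_derivative[OF this assms(2)], of 1 2]
  show ?thesis by (simp add: v)
qed

text \<open>
  The length of a tangent vector in homogeneous coordinates; unlike the coordinate expressions, this
  does not distinguish the two charts.
\<close>

definition eh_norm_sq_hom :: "real \<Rightarrow> complex \<times> complex \<times> complex \<Rightarrow> complex \<times> complex \<times> complex \<Rightarrow> real" where
  "eh_norm_sq_hom t = (\<lambda>(a, b, g) (a', b', g').
     let m = (cmod a)\<^sup>2 + (cmod b)\<^sup>2; s = sqrt ((cmod g * m)\<^sup>2 + t^4)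
     in 2 * (s * (cmod (a' * b - a * b') / m)\<^sup>2 +
             (cmod (of_real (m / 2) * g' + g * (cnj a * a' + cnj b * b')))\<^sup>2 / s))"

text \<open>Exchanging the first two coordinates only changes the sign of
  \<open>a' * b - a * b'\<close>, which enters through its modulus.\<close>

lemma eh_norm_sq_hom_swap: "eh_norm_sq_hom t (b, a, g) (b', a', g') = eh_norm_sq_hom t (a, b, g) (a', b', g')"
proof -
  have "cmod (b' * a - b * a') = cmod (a' * b - a * b')"
    by (subst norm_minus_commute) (simp add: mult.commute)
  then show ?thesis
    unfolding eh_norm_sq_hom_def Let_def split
    by (simp only: add.commute[of "(cmod b)\<^sup>2"] add.commute[of "cnj b * b'"])
qed

text \<open>The tangent vector is the derivative of \<open>(a / b, g * b^2)\<close>. In passing to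
  homogeneous coordinates \<open>eh_theta\<close> only acquires the unimodular factor
  \<open>b / cnj b\<close>.\<close>

lemma eh_metric_hom:
  assumes t: "t > 0" and b: "b \<noteq> 0"
  shows "eh_metric t i (vector [a / b, g * b\<^sup>2]) (vector [(a' * b - a * b') / b\<^sup>2, g' * b\<^sup>2 + g * (2 * b * b')])
            (vector [(a' * b - a * b') / b\<^sup>2, g' * b\<^sup>2 + g * (2 * b * b')]) =
         eh_norm_sq_hom t (a, b, g) (a', b', g')"
proof -
  define m where "m = (cmod a)\<^sup>2 + (cmod b)\<^sup>2"
  define p :: "complex^2" where "p = vector [a / b, g * b\<^sup>2]"
  define X :: "complex^2" where "X = vector [(a' * b - a * b') / b\<^sup>2, g' * b\<^sup>2 + g * (2 * b * b')]"
  have N: "eh_N p = m / (cmod b)\<^sup>2"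
    using b by (simp add: eh_N_def p_def m_def norm_divide power_divide field_simps)
  have m: "m > 0" using b by (simp add: m_def add_nonneg_pos)
  have S: "eh_S t p = sqrt ((cmod g * m)\<^sup>2 + t^4)"
    using b unfolding eh_S_def N by (simp add: p_def norm_mult norm_power power_mult_distrib field_simps)
  have 1: "cmod (X$1) / eh_N p = cmod (a' * b - a * b') / m"
    using b unfolding N by (simp add: X_def norm_divide norm_power)
  have mc: "of_real m = a * cnj a + b * cnj b"
    unfolding m_def by (simp add: complex_norm_square del: of_real_power)
  have bc: "(of_real (cmod b))\<^sup>2 = b * cnj b"
    using complex_norm_square[of b] by simp
  \<comment> \<open>\<open>A\<close> and \<open>B\<close> stand for the conjugates of
    \<open>a\<close> and \<open>b\<close>, which turns the claim into an identity of rational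
    functions.\<close>
  have aux: "(a * A + b * B) / (b * B) / 2 * (g' * b\<^sup>2 + g * (2 * b * b')) + g * b\<^sup>2 * (A / B) * ((a' * b - a * b') / b\<^sup>2)
      = (b / B) * ((a * A + b * B) / 2 * g' + g * (A * a' + B * b'))" if "B \<noteq> 0" for A B
    using that b by (simp add: divide_simps) (simp add: algebra_simps power2_eq_square)
  have "eh_theta p X = (b / cnj b) * (of_real (m / 2) * g' + g * (cnj a * a' + cnj b * b'))"
    using b aux[of "cnj b" "cnj a"] unfolding eh_theta_def N
    by (simp add: p_def X_def bc mc)
  then have 2: "cmod (eh_theta p X) = cmod (of_real (m / 2) * g' + g * (cnj a * a' + cnj b * b'))"
    using b by (simp add: norm_mult norm_divide)
  show ?thesis
    unfolding p_def[symmetric] X_def[symmetric] eh_metric_diag[OF t] 1 2 S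
    by (simp add: eh_norm_sq_hom_def Let_def m_def)
qed

lemma has_vector_derivative_quotient:
  fixes a b :: "real \<Rightarrow> complex"
  assumes "(a has_vector_derivative a') (at s)" "(b has_vector_derivative b') (at s)" "b s \<noteq> 0"
  shows "((\<lambda>s. a s / b s) has_vector_derivative (a' * b s - a s * b') / (b s)\<^sup>2) (at s)"
  using assms unfolding has_vector_derivative_def
  by (auto intro!: derivative_eq_intros simp: field_simps power2_eq_square scaleR_conv_of_real)

lemma has_vector_derivative_chart:
  fixes a b g :: "real \<Rightarrow> complex"
  assumes "b s \<noteq> 0" "(a has_vector_derivative a') (at s)" "(b has_vector_derivative b') (at s)"
    "(g has_vector_derivative g') (at s)"
  shows "((\<lambda>s. vector [a s / b s, g s * (b s)\<^sup>2] :: complex^2) has_vector_derivative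
    vector [(a' * b s - a s * b') / (b s)\<^sup>2, g' * (b s)\<^sup>2 + g s * (2 * b s * b')]) (at s)"
proof (rule has_vector_derivative_vec2)
  show "((\<lambda>s. a s / b s) has_vector_derivative (a' * b s - a s * b') / (b s)\<^sup>2) (at s)"
    using assms by (intro has_vector_derivative_quotient)
  show "((\<lambda>s. g s * (b s)\<^sup>2) has_vector_derivative g' * (b s)\<^sup>2 + g s * (2 * b s * b')) (at s)"
    using assms unfolding has_vector_derivative_def
    by (auto intro!: derivative_eq_intros simp: algebra_simps power2_eq_square scaleR_conv_of_real)
qed

text \<open>Where \<open>b s = 0\<close>, \<open>eh_speed\<close> is computed in the chart at
  infinity; its formula is the affine one with \<open>a\<close> and \<open>b\<close> exchanged, and
  the homogeneous norm is symmetric under this exchange.\<close>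

lemma eh_speed_class:
  assumes t: "t > 0"
    and d: "(a has_vector_derivative a') (at s)" "(b has_vector_derivative b') (at s)"
      "(g has_vector_derivative g') (at s)"
    and nz: "\<And>s. (a s, b s) \<noteq> (0, 0)"
  shows "eh_speed t (\<lambda>s. H2_class (a s) (b s) (g s)) s = sqrt (eh_norm_sq_hom t (a s, b s, g s) (a', b', g'))"
proof -
  show ?thesis
  proof (cases "b s = 0")
    case False
    \<comment> \<open>This also holds where \<open>b\<close> vanishes, as both sides then have the
      value of division by 0.\<close>
    have "H2_coord Affine \<circ> (\<lambda>s. H2_class (a s) (b s) (g s)) = (\<lambda>s. vector [a s / b s, g s * (b s)\<^sup>2])"
      using nz by (simp add: fun_eq_iff H2_coord_class del: H2_coord.simps)
    then show ?thesis
      using False vector_derivative_at[OF has_vector_derivative_chart[OF False d]] nz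
      by (simp add: eh_speed_def Let_def chart_at_def H2_proj_class H2_coord_class eh_metric_hom[OF t False]
           del: H2_coord.simps)
  next
    case True
    with nz[of s] have nz': "a s \<noteq> 0" by auto
    have "H2_coord Infinity \<circ> (\<lambda>s. H2_class (a s) (b s) (g s)) = (\<lambda>s. vector [b s / a s, g s * (a s)\<^sup>2])"
      using nz by (simp add: fun_eq_iff H2_coord_class del: H2_coord.simps)
    then show ?thesis
      using True vector_derivative_at[OF has_vector_derivative_chart[OF nz' d(2,1,3)]] nz[of s] nz'
        eh_norm_sq_hom_swap[of t "a s" "b s" "g s" a' b' g']
        eh_metric_hom[OF t nz', of Infinity "b s" "g s" b' a' g']
      unfolding eh_speed_def
      by (simp add: Let_def chart_at_def H2_proj_class H2_coord_class del: H2_coord.simps)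
  qed
qed

section \<open>Bounding the distance from below\<close>

text \<open>As \<open>v\<close> may be non-measurable, the comparison goes through the derivative of
  \<open>f\<close>: it has a gauge integral equal to the increment, and is therefore
  measurable.\<close>

lemma increment_le_nn_integral:
  fixes f v :: "real \<Rightarrow> real"
  assumes "finite F" and cont: "continuous_on {0..1} f"
    and deriv: "\<And>s. s \<in> {0<..<1} - F \<Longrightarrow> \<exists>d. (f has_real_derivative d) (at s) \<and> \<bar>d\<bar> \<le> v s"
  shows "ennreal (f 1 - f 0) \<le> (\<integral>\<^sup>+ s\<in>{0..1}. ennreal (v s) \<partial>lborel)"
proof -
  obtain d where d: "\<And>s. s \<in> {0<..<1} - F \<Longrightarrow> (f has_real_derivative d s) (at s) \<and> \<bar>d s\<bar> \<le> v s"
    using deriv by metis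
  \<comment> \<open>Setting the derivative to 0 at the finitely many exceptional points and outside
    the open interval does not affect its integral.\<close>
  define d' where "d' = (\<lambda>s. if s \<in> {0<..<1} - F then d s else 0)"
  have int: "(d' has_integral (f 1 - f 0)) {0..1}"
    by (rule fundamental_theorem_of_calculus_interior_strong[OF \<open>finite F\<close> _ _ cont])
       (use d in \<open>auto simp: d'_def has_real_derivative_iff_has_vector_derivative\<close>)
  define M where "M = lebesgue_on {0..1::real}"
  have meas: "d' \<in> borel_measurable M"
    unfolding M_def using int by (blast intro: integrable_imp_measurable)
  have eq: "(\<integral>\<^sup>+ s. ennreal (norm (d' s)) \<partial>M) = (\<integral>\<^sup>+ s\<in>{0..1}. ennreal \<bar>d' s\<bar> \<partial>lborel)"
    unfolding M_def by (subst nn_integral_restrict_space) (simp_all add: nn_integral_completion)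
  have le: "(\<integral>\<^sup>+ s\<in>{0..1}. ennreal \<bar>d' s\<bar> \<partial>lborel) \<le> (\<integral>\<^sup>+ s\<in>{0..1}. ennreal (v s) \<partial>lborel)"
    by (intro nn_integral_mono) (use d in \<open>auto simp: d'_def indicator_def intro: ennreal_leI\<close>)
  show ?thesis
  \<comment> \<open>If the absolute integral is infinite there is nothing to show. Otherwise the
    derivative is Lebesgue integrable and both integrals agree.\<close>
  proof (cases "(\<integral>\<^sup>+ s. ennreal (norm (d' s)) \<partial>M) = \<infinity>")
    case True
    then show ?thesis using le eq by (simp add: top_unique)
  next
    case False
    then have i: "integrable M d'"
      using meas by (simp add: integrable_iff_bounded less_top)
    have "integral\<^sup>L M d' = f 1 - f 0"
      using lebesgue_integral_eq_integral[OF i[unfolded M_def]] int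
      by (simp add: M_def integral_unique)
    then have "ennreal \<bar>f 1 - f 0\<bar> \<le> (\<integral>\<^sup>+ s. ennreal (norm (d' s)) \<partial>M)"
      using integral_norm_bound_ennreal[OF i] by simp
    moreover have "ennreal (f 1 - f 0) \<le> ennreal \<bar>f 1 - f 0\<bar>"
      by (intro ennreal_leI) simp
    ultimately show ?thesis using le eq by (metis order_trans)
  qed
qed

section \<open>Points, charts and the transition between them\<close>

lemma H2_cases:
  obtains a b g where "(a, b) \<noteq> (0, 0)" "x = H2_class a b g"
proof -
  obtain a b g where r: "rep_H2 x = (a, b, g)"
    by (cases "rep_H2 x")
  have "eh_rel (rep_H2 x) (rep_H2 x)" "abs_H2 (rep_H2 x) = x"
    using Quotient3_rep_reflp[OF Quotient3_H2] Quotient3_abs_rep[OF Quotient3_H2] by auto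
  then show thesis
    using that[of a b g] by (auto simp: r eh_rel_def H2_class_def)
qed

lemma H2_point_coord:
  assumes "x \<in> H2_dom i"
  shows "H2_point i (H2_coord i x) = x"
proof -
  obtain a b g where x: "(a, b) \<noteq> (0, 0)" "x = H2_class a b g"
    by (rule H2_cases)
  show ?thesis
  proof (cases i)
    case Affine
    with assms x have "b \<noteq> 0" by (auto simp: H2_dom_def H2_proj_class)
    with H2_class_scale[of "a / b" 1 b g] x Affine show ?thesis
      by (simp add: H2_coord_class del: H2_coord.simps)
  next
    case Infinity
    with assms x have "a \<noteq> 0" by (auto simp: H2_dom_def H2_proj_class split: if_splits)
    with H2_class_scale[of 1 "b / a" a g] x Infinity show ?thesis
      by (simp add: H2_coord_class del: H2_coord.simps)
  qed
qed

text \<open>Only the transition from infinity to the affine chart has to be treated, because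
  \<open>chart_at\<close> selects the affine chart at every point that it contains.\<close>

lemma H2_dom_Affine_iff:
  assumes "x \<in> H2_dom Infinity"
  shows "x \<in> H2_dom Affine \<longleftrightarrow> H2_coord Infinity x $ 1 \<noteq> 0"
proof -
  obtain a b g where x: "(a, b) \<noteq> (0, 0)" "x = H2_class a b g"
    by (rule H2_cases)
  with assms show ?thesis
    by (auto simp: H2_dom_def H2_proj_class H2_coord_class simp del: H2_coord.simps split: if_splits)
qed

lemma H2_coord_transition:
  assumes "x \<in> H2_dom Infinity" "x \<in> H2_dom Affine"
  shows "H2_coord Affine x =
    vector [inverse (H2_coord Infinity x $ 1), H2_coord Infinity x $ 2 * (H2_coord Infinity x $ 1)\<^sup>2]"
  using H2_point_coord[OF assms(1)] H2_coord_class(1)[of 1 "H2_coord Infinity x $ 1" "H2_coord Infinity x $ 2"]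
  by (simp add: inverse_eq_divide del: H2_coord.simps)

text \<open>The function \<open>sqrt S\<close>, written through \<open>eh_u1\<close> so that it is
  visibly independent of the chart.\<close>

definition eh_rho :: "real \<Rightarrow> H2 \<Rightarrow> real" where
  "eh_rho t x = sqrt (sqrt ((eh_u1 x)\<^sup>2 + t^4))"

lemma eh_rho_coord:
  assumes "x \<in> H2_dom i"
  shows "eh_rho t x = sqrt (eh_S t (H2_coord i x))"
  using eh_u1_point[of i "H2_coord i x"] H2_point_coord[OF assms]
  by (simp add: eh_rho_def eh_S_def power_mult_distrib)

text \<open>The differential of \<open>sqrt S\<close> is that of \<open>S\<close> divided by
  \<open>2 * sqrt S\<close>. Since the latter is at most \<open>2 |theta|\<close>, the quotient is
  at most \<open>|theta| / sqrt S\<close>, which is bounded by the length of the tangent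
  vector.\<close>

lemma eh_rho_deriv_chart_at:
  assumes t: "t > 0" and j: "j = chart_at (H2_proj (x s))"
    and ev: "eventually (\<lambda>\<tau>. x \<tau> \<in> H2_dom j) (nhds s)"
    and d: "(H2_coord j \<circ> x) differentiable (at s)"
  shows "\<exists>d. ((\<lambda>\<tau>. eh_rho t (x \<tau>)) has_real_derivative d) (at s) \<and> \<bar>d\<bar> \<le> eh_speed t x s"
proof -
  define V where "V = vector_derivative (H2_coord j \<circ> x) (at s)"
  define p where "p = H2_coord j (x s)"
  define c where "c = ((eh_N p)\<^sup>2 * Re (cnj (p$2) * V$2) + 2 * (cmod (p$2))\<^sup>2 * eh_N p * Re (cnj (p$1) * V$1)) / eh_S t p"
  have S: "eh_S t p > 0" by (rule eh_S_pos[OF t])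
  have V: "((H2_coord j \<circ> x) has_vector_derivative V) (at s)"
    unfolding V_def using d by (rule vector_derivative_works[THEN iffD1])
  have "((eh_S t \<circ> (H2_coord j \<circ> x)) has_derivative
     (\<lambda>h. ((eh_N p)\<^sup>2 * Re (cnj (p$2) * h$2) + 2 * (cmod (p$2))\<^sup>2 * eh_N p * Re (cnj (p$1) * h$1)) / eh_S t p)
       \<circ> (\<lambda>u. u *\<^sub>R V)) (at s)"
    by (rule diff_chain_at) (use V has_derivative_eh_S[OF t, of p] in \<open>simp_all add: has_vector_derivative_def p_def\<close>)
  then have 1: "((eh_S t \<circ> (H2_coord j \<circ> x)) has_real_derivative c) (at s)"
    unfolding has_field_derivative_def
    by (rule has_derivative_eq_rhs) (simp add: fun_eq_iff c_def algebra_simps add_divide_distrib)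
  have "((\<lambda>\<tau>. sqrt ((eh_S t \<circ> (H2_coord j \<circ> x)) \<tau>)) has_real_derivative (inverse (sqrt (eh_S t p)) / 2) * c) (at s)"
    by (rule DERIV_chain2[OF _ 1]) (use S in \<open>simp add: p_def DERIV_real_sqrt\<close>)
  then have "((\<lambda>\<tau>. eh_rho t (x \<tau>)) has_real_derivative (inverse (sqrt (eh_S t p)) / 2) * c) (at s)"
    by (rule DERIV_cong_ev[THEN iffD1, OF refl _ refl, rotated])
       (use ev in \<open>auto elim!: eventually_mono simp: eh_rho_coord\<close>)
  moreover have "\<bar>inverse (sqrt (eh_S t p)) / 2 * c\<bar> \<le> eh_speed t x s"
  proof -
    have "c = 2 * eh_N p * Re (cnj (p$2) * eh_theta p V) / eh_S t p"
      unfolding c_def eh_theta_def cmod_power2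
      by (simp add: algebra_simps power2_eq_square add_divide_distrib)
    then have "\<bar>c\<bar> = 2 * eh_N p * \<bar>Re (cnj (p$2) * eh_theta p V)\<bar> / eh_S t p"
      using S eh_N_pos[of p] by (simp add: abs_mult)
    also have "\<dots> \<le> 2 * eh_N p * (cmod (p$2) * cmod (eh_theta p V)) / eh_S t p"
      using S eh_N_pos[of p] abs_Re_le_cmod[of "cnj (p$2) * eh_theta p V"]
      by (intro divide_right_mono mult_left_mono) (auto simp: norm_mult)
    also have "\<dots> = 2 * cmod (eh_theta p V) * ((cmod (p$2) * eh_N p) / eh_S t p)"
      by simp
    \<comment> \<open>Here \<open>cmod (p$2) * eh_N p\<close>, the value of \<open>eh_u1\<close>, is
      at most \<open>S\<close>.\<close>
    also have "\<dots> \<le> 2 * cmod (eh_theta p V) * 1"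
    proof (intro mult_left_mono)
      have "cmod (p$2) * eh_N p \<le> eh_S t p"
        unfolding eh_S_def power_mult_distrib[symmetric] by (rule real_le_rsqrt) simp
      then show "cmod (p$2) * eh_N p / eh_S t p \<le> 1"
        using S by simp
    qed simp
    finally have c: "\<bar>c\<bar> \<le> 2 * cmod (eh_theta p V)" by simp
    have "\<bar>inverse (sqrt (eh_S t p)) / 2 * c\<bar> = \<bar>c\<bar> / (2 * sqrt (eh_S t p))"
      using S by (simp add: abs_mult field_simps)
    also have "\<dots> \<le> 2 * cmod (eh_theta p V) / (2 * sqrt (eh_S t p))"
      using c S by (intro divide_right_mono) auto
    also have "\<dots> = sqrt ((cmod (eh_theta p V))\<^sup>2 / eh_S t p)"
      by (simp add: real_sqrt_divide)
    \<comment> \<open>The base term of the squared length and half of the fibre term are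
      dropped.\<close>
    also have "\<dots> \<le> sqrt (eh_metric t j p V V)"
    proof (rule real_sqrt_le_mono)
      have aux: "b \<le> 2 * (a + b)" if "0 \<le> a" "0 \<le> b" for a b :: real
        using that by simp
      have "0 \<le> eh_S t p * (cmod (V$1) / eh_N p)\<^sup>2" "0 \<le> (cmod (eh_theta p V))\<^sup>2 / eh_S t p"
        using S by auto
      then show "(cmod (eh_theta p V))\<^sup>2 / eh_S t p \<le> eh_metric t j p V V"
        unfolding eh_metric_diag[OF t] by (rule aux)
    qed
    finally show ?thesis
      by (simp add: eh_speed_def Let_def j[symmetric] V_def p_def)
  qed
  ultimately show ?thesis by blast
qed

text \<open>A path is differentiable in some chart, whereas \<open>eh_speed\<close> uses the chart
  of \<open>chart_at\<close>. If they differ, the path is first rewritten in the affine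
  chart.\<close>

lemma eh_rho_deriv:
  assumes t: "t > 0"
    and ev: "eventually (\<lambda>\<tau>. x \<tau> \<in> H2_dom i) (nhds s)"
    and d: "(H2_coord i \<circ> x) differentiable (at s)"
  shows "\<exists>d. ((\<lambda>\<tau>. eh_rho t (x \<tau>)) has_real_derivative d) (at s) \<and> \<bar>d\<bar> \<le> eh_speed t x s"
proof -
  define j where "j = chart_at (H2_proj (x s))"
  have xs: "x s \<in> H2_dom i"
    using ev by (rule eventually_nhds_x_imp_x)
  show ?thesis
  proof (cases "j = i")
    case True
    with assms eh_rho_deriv_chart_at[OF t, of j x s] j_def show ?thesis by simp
  next
    case False
    with xs have ij: "i = Infinity" "j = Affine" and a: "x s \<in> H2_dom Affine"
      by (cases i; auto simp: j_def chart_at_def H2_dom_def split: if_splits)+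
    define q where "q = H2_coord Infinity \<circ> x"
    have q1: "q s $ 1 \<noteq> 0"
      using a xs H2_dom_Affine_iff[of "x s"] by (simp add: q_def ij)
    obtain D where D: "(q has_vector_derivative D) (at s)"
      using d unfolding ij(1) q_def[symmetric] by (metis vector_derivative_works)
    have Dn: "((\<lambda>\<tau>. q \<tau> $ m) has_vector_derivative D $ m) (at s)" for m
      by (rule bounded_linear.has_vector_derivative[OF bounded_linear_vec_nth D])
    have "isCont (\<lambda>\<tau>. q \<tau> $ 1) s"
      using Dn[of 1] by (rule has_vector_derivative_continuous)
    \<comment> \<open>By continuity the path avoids the fibre over infinity near \<open>s\<close>,
      so the transition formula holds on a neighbourhood.\<close>
    then have "eventually (\<lambda>\<tau>. q \<tau> $ 1 \<noteq> 0) (at s)"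
      using q1 by (auto simp: isCont_def intro: tendsto_imp_eventually_ne)
    with q1 have "eventually (\<lambda>\<tau>. q \<tau> $ 1 \<noteq> 0) (nhds s)"
      by (simp add: eventually_nhds_conv_at)
    with ev have ev': "eventually (\<lambda>\<tau>. x \<tau> \<in> H2_dom Infinity \<and> x \<tau> \<in> H2_dom Affine) (nhds s)"
      by eventually_elim (auto simp: ij q_def H2_dom_Affine_iff)
    have 1: "((\<lambda>\<tau>. inverse (q \<tau> $ 1)) has_vector_derivative - (inverse (q s $ 1) * (D$1) * inverse (q s $ 1))) (at s)"
      using Dn[of 1] q1 unfolding has_vector_derivative_def
      by (auto intro!: derivative_eq_intros simp: fun_eq_iff)
    have 2: "((\<lambda>\<tau>. q \<tau> $ 2 * (q \<tau> $ 1)\<^sup>2) has_vector_derivative (D$2 * (q s $ 1)\<^sup>2 + q s $ 2 * (2 * q s $ 1 * D $ 1))) (at s)"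
      using Dn[of 1] Dn[of 2] unfolding has_vector_derivative_def
      by (auto intro!: derivative_eq_intros simp: fun_eq_iff algebra_simps)
    obtain D' where D': "((\<lambda>\<tau>. vector [inverse (q \<tau> $ 1), q \<tau> $ 2 * (q \<tau> $ 1)\<^sup>2] :: complex^2) has_derivative D') (at s)"
      using has_vector_derivative_vec2[OF 1 2] unfolding has_vector_derivative_def by blast
    have "eventually (\<lambda>\<tau>. vector [inverse (q \<tau> $ 1), q \<tau> $ 2 * (q \<tau> $ 1)\<^sup>2] = (H2_coord Affine \<circ> x) \<tau>) (nhds s)"
      using ev' by eventually_elim (simp add: q_def H2_coord_transition del: H2_coord.simps)
    then have "((H2_coord Affine \<circ> x) has_derivative D') (at s)"
      by (intro has_derivative_transform_eventually[OF D'])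
         (auto simp: eventually_nhds_conv_at simp del: H2_coord.simps)
    then have "(H2_coord Affine \<circ> x) differentiable (at s)"
      by (auto simp: differentiable_def)
    moreover have "eventually (\<lambda>\<tau>. x \<tau> \<in> H2_dom Affine) (nhds s)"
      using ev' by eventually_elim simp
    ultimately show ?thesis
      using eh_rho_deriv_chart_at[OF t, of j x s] j_def by (simp add: ij del: H2_coord.simps)
  qed
qed

lemma H2_path_locally:
  assumes "H2_path x" "u \<in> {0..1}"
  shows "\<exists>i e F. e > 0 \<and> finite F \<and> x ` (cball u e \<inter> {0..1}) \<subseteq> H2_dom i \<and>
    continuous_on (cball u e \<inter> {0..1}) (H2_coord i \<circ> x) \<and>
    (\<forall>s\<in>cball u e \<inter> {0..1} - F. (H2_coord i \<circ> x) differentiable (at s))"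
  using assms unfolding H2_path_def piecewise_C1_differentiable_on_def C1_differentiable_on_eq
  by (meson DiffI)

text \<open>Finitely many of the local pieces cover the unit interval, so the exceptional points
  form a finite set and the infinitesimal estimate can be integrated.\<close>

lemma eh_rho_Lipschitz:
  assumes t: "t > 0" and x: "H2_path x"
  shows "ennreal (eh_rho t (x 1) - eh_rho t (x 0)) \<le> eh_length t x"
proof -
  define Q where "Q = (\<lambda>u i e F. e > 0 \<and> finite F \<and>
      x ` (cball u e \<inter> {0..1}) \<subseteq> H2_dom i \<and>
      continuous_on (cball u e \<inter> {0..1}) (H2_coord i \<circ> x) \<and>
      (\<forall>s\<in>cball u e \<inter> {0..1} - F. (H2_coord i \<circ> x) differentiable (at s)))"
  have "\<forall>u\<in>{0..1}. \<exists>i e F. Q u i e F"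
    unfolding Q_def using H2_path_locally[OF x] by (rule ballI)
  from bchoice[OF this] obtain i where "\<forall>u\<in>{0..1}. \<exists>e F. Q u (i u) e F" ..
  from bchoice[OF this] obtain e where "\<forall>u\<in>{0..1}. \<exists>F. Q u (i u) (e u) F" ..
  from bchoice[OF this] obtain F where Q: "\<forall>u\<in>{0..1}. Q u (i u) (e u) (F u)" ..
  have loc: "e u > 0 \<and> finite (F u) \<and>
      x ` (cball u (e u) \<inter> {0..1}) \<subseteq> H2_dom (i u) \<and>
      continuous_on (cball u (e u) \<inter> {0..1}) (H2_coord (i u) \<circ> x) \<and>
      (\<forall>s\<in>cball u (e u) \<inter> {0..1} - F u. (H2_coord (i u) \<circ> x) differentiable (at s))"
    if "u \<in> {0..1}" for u
    using bspec[OF Q that] unfolding Q_def .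
  have cov: "{0..1} \<subseteq> (\<Union>u\<in>{0..1}. ball u (e u))"
  proof
    fix u :: real assume u: "u \<in> {0..1}"
    then have "u \<in> ball u (e u)" using loc[OF u] by simp
    with u show "u \<in> (\<Union>u\<in>{0..1}. ball u (e u))" by (rule UN_I)
  qed
  obtain C where C: "C \<subseteq> {0..1::real}" "finite C" "{0..1} \<subseteq> (\<Union>u\<in>C. ball u (e u))"
    by (rule compactE_image[OF compact_Icc open_ball cov])
  show ?thesis
    unfolding eh_length_def
  proof (rule increment_le_nn_integral)
    show "finite (\<Union>u\<in>C. F u)"
      using C loc by blast
    show "continuous_on {0..1} (\<lambda>s. eh_rho t (x s))"
      unfolding continuous_on_eq_continuous_within
    proof
      fix s :: real assume s: "s \<in> {0..1}"
      then have e: "e s > 0" "s \<in> cball s (e s) \<inter> {0..1}"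
        using loc[OF s] s by auto
      have "continuous_on ((H2_coord (i s) \<circ> x) ` (cball s (e s) \<inter> {0..1})) (eh_S t)"
        by (rule continuous_on_subset[OF continuous_on_eh_S[OF t] subset_UNIV])
      then have "continuous_on (cball s (e s) \<inter> {0..1}) (eh_S t \<circ> (H2_coord (i s) \<circ> x))"
        using loc[OF s] by (intro continuous_on_compose) blast+
      from continuous_on_real_sqrt[OF this]
      have "continuous_on (cball s (e s) \<inter> {0..1}) (\<lambda>\<tau>. sqrt (eh_S t ((H2_coord (i s) \<circ> x) \<tau>)))"
        by (simp only: comp_def)
      moreover have "sqrt (eh_S t ((H2_coord (i s) \<circ> x) \<tau>)) = eh_rho t (x \<tau>)" if "\<tau> \<in> cball s (e s) \<inter> {0..1}" for \<tau>
      proof -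
        have "x \<tau> \<in> H2_dom (i s)"
          using loc[OF s] that by blast
        then show ?thesis
          by (simp add: eh_rho_coord)
      qed
      ultimately have "continuous_on (cball s (e s) \<inter> {0..1}) (\<lambda>s. eh_rho t (x s))"
        by (rule continuous_on_eq)
      then have "continuous (at s within cball s (e s) \<inter> {0..1}) (\<lambda>s. eh_rho t (x s))"
        using e by (auto simp: continuous_on_eq_continuous_within)
      \<comment> \<open>Continuity within the interval is a local property, so the ball around
        \<open>s\<close> suffices.\<close>
      moreover have "at s within {0..1} = at s within cball s (e s) \<inter> {0..1}"
        by (rule at_within_nhd[of s "ball s (e s)"]) (use e in auto)
      ultimately show "continuous (at s within {0..1}) (\<lambda>s. eh_rho t (x s))"
        by simp
    qed
    fix s :: real assume s: "s \<in> {0<..<1} - (\<Union>u\<in>C. F u)"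
    then have "s \<in> {0..1}" by auto
    with C obtain u where u: "u \<in> C" "s \<in> ball u (e u)" by blast
    from u C have "u \<in> {0..1}" by blast
    note l = loc[OF this]
    \<comment> \<open>The derivative at \<open>s\<close> is two-sided, so a full neighbourhood of
      \<open>s\<close> must be mapped into the chart domain.\<close>
    have "open (ball u (e u) \<inter> {0<..<1})" "s \<in> ball u (e u) \<inter> {0<..<1}"
      using u s by auto
    then have "eventually (\<lambda>\<tau>. \<tau> \<in> ball u (e u) \<inter> {0<..<1}) (nhds s)"
      by (rule eventually_nhds_in_open)
    then have "eventually (\<lambda>\<tau>. x \<tau> \<in> H2_dom (i u)) (nhds s)"
      by (rule eventually_mono) (use l in \<open>auto simp: image_subset_iff\<close>)
    moreover have "(H2_coord (i u) \<circ> x) differentiable (at s)"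
      using l u s by auto
    ultimately show "\<exists>d. ((\<lambda>s. eh_rho t (x s)) has_real_derivative d) (at s) \<and> \<bar>d\<bar> \<le> eh_speed t x s"
      by (rule eh_rho_deriv[OF t])
  qed
qed

text \<open>A connecting path of length below \<open>R\<close> raises \<open>eh_rho\<close> by at
  most \<open>R\<close>, and \<open>eh_u1\<close> is bounded by the square of
  \<open>eh_rho\<close>.\<close>

lemma u1_le_on_ball:
  assumes t: "t > 0" and x: "x \<in> M3_ball t \<kappa> q R" and R: "R \<ge> 0"
  shows "eh_u1 x \<le> (eh_rho t q + R)\<^sup>2"
proof -
  have "M3_dist t \<kappa> q x < ennreal R"
    using x by (simp add: M3_ball_def)
  then obtain y where y: "H2_path y" "y 0 = q" "y 1 = x" "eh_length t y < ennreal R"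
    unfolding M3_dist_def INF_less_iff by auto
  have "ennreal (eh_rho t x - eh_rho t q) < ennreal R"
    using eh_rho_Lipschitz[OF t y(1)] y by auto
  \<comment> \<open>A negative difference is truncated by \<open>ennreal\<close>; the claim then
    follows from \<open>R \<ge> 0\<close>.\<close>
  then have "eh_rho t x \<le> eh_rho t q + R"
    using R by (cases "eh_rho t x - eh_rho t q \<ge> 0") (auto simp: ennreal_less_iff)
  moreover have "eh_u1 x \<le> (eh_rho t x)\<^sup>2" "0 \<le> eh_rho t x"
    by (auto simp: eh_rho_def intro!: real_le_rsqrt)
  ultimately show ?thesis
    by (meson power_mono order_trans)
qed

section \<open>Volume density and admissible paths\<close>

text \<open>Eliminating the two fibre directions removes the contribution of \<open>x\<close> and
  \<open>y\<close> from the first entry, leaving \<open>2 * S * k^2 / n^2\<close> times the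
  determinant of the diagonal fibre block.\<close>

lemma gram_det_identity:
  fixes S n x y k :: real
  assumes "S > 0" "n > 0"
  shows "det (\<chi> i j. if i = 1 \<and> j = 1 then 2 * (S * k\<^sup>2 / n\<^sup>2 + (x\<^sup>2 + y\<^sup>2) / S)
      else if i = 1 \<and> j = 2 \<or> i = 2 \<and> j = 1 then n * x / S
      else if i = 1 \<and> j = 3 \<or> i = 3 \<and> j = 1 then n * y / S
      else if i = j then n\<^sup>2 / (2 * S) else 0 :: real^3^3) = (k * n)\<^sup>2 / (2 * S)"
  using assms by (simp add: det_3) (simp add: field_simps power2_eq_square)

lemma M3_density_eq:
  fixes \<kappa> s w t
  defines "p \<equiv> M3_coord \<kappa> s w"
  defines "k \<equiv> vector_derivative (P1_coord (chart_at (\<kappa> s)) \<circ> \<kappa>) (at s)"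
  assumes t: "t > 0"
  shows "M3_density t \<kappa> s w = cmod k * eh_N p / sqrt (2 * eh_S t p)"
proof -
  define i where "i = chart_at (\<kappa> s)"
  have S: "eh_S t p > 0" by (rule eh_S_pos[OF t])
  define q where "q = p$2 * cnj (p$1) * k"
  define G :: "real^3^3" where "G = (\<chi> m n. eh_metric t i p (M3_frame \<kappa> s $ m) (M3_frame \<kappa> s $ n))"
  have F: "M3_frame \<kappa> s $ 1 = vector [k, 0]" "M3_frame \<kappa> s $ 2 = vector [0, 1]" "M3_frame \<kappa> s $ 3 = vector [0, \<i>]"
    by (simp_all add: M3_frame_def k_def)
  have G11: "G$1$1 = 2 * (eh_S t p * (cmod k)\<^sup>2 / (eh_N p)\<^sup>2 + ((Re q)\<^sup>2 + (Im q)\<^sup>2) / eh_S t p)"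
    by (simp add: G_def F eh_metric_diag[OF t] eh_theta_def q_def[symmetric] power_divide)
       (simp add: cmod_power2)
  have G: "G$1$2 = eh_N p * Re q / eh_S t p" "G$2$1 = eh_N p * Re q / eh_S t p"
    "G$1$3 = eh_N p * Im q / eh_S t p" "G$3$1 = eh_N p * Im q / eh_S t p"
    "G$2$3 = 0" "G$3$2 = 0"
    "G$2$2 = (eh_N p)\<^sup>2 / (2 * eh_S t p)" "G$3$3 = (eh_N p)\<^sup>2 / (2 * eh_S t p)"
    unfolding G_def F
    by (simp_all add: F eh_metric_eq[OF t] q_def power2_eq_square algebra_simps add_divide_distrib diff_divide_distrib)
  have "det G = (cmod k * eh_N p)\<^sup>2 / (2 * eh_S t p)"
    unfolding gram_det_identity[OF S eh_N_pos[of p], of "cmod k" "Re q" "Im q", symmetric]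
    by (rule arg_cong[of _ _ det]) (simp add: vec_eq_iff forall_3 G G11)
  then show ?thesis
    unfolding M3_density_def p_def[symmetric] G_def[symmetric] i_def[symmetric]
    using eh_N_pos[of p] by (simp add: real_sqrt_divide)
qed

text \<open>By Tonelli: the weight \<open>(n s)^2\<close> exactly cancels the shrinking of the disc
  of radius \<open>r / n s\<close>, so every fibre contributes the same amount.\<close>

lemma disc_bundle_integral:
  fixes n :: "real \<Rightarrow> real"
  assumes [measurable]: "n \<in> borel_measurable borel" and n: "\<And>s. n s > 0" and r: "r \<ge> 0"
  shows "(\<integral>\<^sup>+ (s, w)\<in>{(s, w :: complex). 0 \<le> s \<and> s < 1 \<and> cmod w * n s \<le> r}. ennreal ((n s)\<^sup>2) \<partial>lborel) = ennreal (pi * r\<^sup>2)"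
proof -
  define f where "f = (\<lambda>(s :: real, w :: complex). ennreal ((n s)\<^sup>2) * indicator {z. 0 \<le> fst z \<and> fst z < 1 \<and> cmod (snd z) * n (fst z) \<le> r} (s, w))"
  have [measurable]: "f \<in> borel_measurable (lborel \<Otimes>\<^sub>M lborel)"
    unfolding f_def by measurable
  have "(\<integral>\<^sup>+ (s, w)\<in>{(s, w :: complex). 0 \<le> s \<and> s < 1 \<and> cmod w * n s \<le> r}. ennreal ((n s)\<^sup>2) \<partial>lborel) = integral\<^sup>N (lborel \<Otimes>\<^sub>M lborel) f"
    unfolding lborel_prod by (intro nn_integral_cong) (auto simp: f_def indicator_def)
  also have "\<dots> = (\<integral>\<^sup>+ s. \<integral>\<^sup>+ w. f (s, w) \<partial>lborel \<partial>lborel)"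
    by (rule lborel.nn_integral_fst[symmetric]) simp
  also have "\<dots> = (\<integral>\<^sup>+ s. ennreal (pi * r\<^sup>2) * indicator {0..<1} s \<partial>(lborel :: real measure))"
  proof (rule nn_integral_cong)
    fix s :: real
    show "(\<integral>\<^sup>+ w. f (s, w) \<partial>lborel) = ennreal (pi * r\<^sup>2) * indicator {0..<1} s"
    proof (cases "s \<in> {0..<1}")
      case True
      have "(\<integral>\<^sup>+ w. f (s, w) \<partial>lborel) = (\<integral>\<^sup>+ w. ennreal ((n s)\<^sup>2) * indicator (cball 0 (r / n s)) w \<partial>(lborel :: complex measure))"
        using True n[of s] by (intro nn_integral_cong) (auto simp: f_def indicator_def field_simps)
      also have "\<dots> = ennreal ((n s)\<^sup>2) * emeasure lborel (cball (0::complex) (r / n s))"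
        by (rule nn_integral_cmult_indicator) simp
      also have "\<dots> = ennreal ((n s)\<^sup>2) * ennreal (pi * (r / n s)\<^sup>2)"
        using n[of s] r by (subst emeasure_cball) (simp_all add: unit_ball_vol_2)
      also have "\<dots> = ennreal (pi * r\<^sup>2)"
        using n[of s] by (simp add: ennreal_mult'[symmetric] power_divide)
      finally show ?thesis using True by simp
    next
      case False
      then have "f (s, w) = 0" for w by (auto simp: f_def)
      with False show ?thesis by simp
    qed
  qed
  also have "\<dots> = ennreal (pi * r\<^sup>2)"
    by (subst nn_integral_cmult_indicator) auto
  finally show ?thesis .
qed

section \<open>Paths given by homogeneous coordinates\<close>

lemma continuous_on_vec2:
  assumes "continuous_on S f" "continuous_on S g"
  shows "continuous_on S (\<lambda>x. vector [f x, g x] :: complex^2)"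
proof -
  have v: "vector [a, b] = (\<chi> i. if i = 1 then a else b :: complex^2)" for a b
    by (simp add: vec_eq_iff forall_2)
  have "continuous_on S (\<lambda>x. if i = 1 then f x else g x)" for i :: 2
    using assms by (cases "i = 1") auto
  then show ?thesis
    unfolding v by (rule continuous_on_vec_lambda)
qed

text \<open>Near each parameter one of the first two coordinates stays away from 0, and dividing by
  it gives a chart expression of class C1.\<close>

lemma H2_path_class:
  assumes d: "\<And>s. (a has_vector_derivative a' s) (at s)" "\<And>s. (b has_vector_derivative b' s) (at s)"
      "\<And>s. (g has_vector_derivative g' s) (at s)"
    and cont: "continuous_on UNIV a'" "continuous_on UNIV b'" "continuous_on UNIV g'"
    and nz: "\<And>s. (a s, b s) \<noteq> (0, 0)"
  shows "H2_path (\<lambda>s. H2_class (a s) (b s) (g s))"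
proof -
  \<comment> \<open>Stated for arbitrary \<open>a\<close> and \<open>b\<close>, so that it applies
    to the chart at infinity with the two exchanged.\<close>
  have nbhd: "\<exists>e>0. (\<forall>s\<in>cball u e. b s \<noteq> 0) \<and> (\<lambda>s. vector [a s / b s, g s * (b s)\<^sup>2] :: complex^2)
      piecewise_C1_differentiable_on (cball u e \<inter> {0..1})"
    if d: "\<And>s. (a has_vector_derivative a' s) (at s)" "\<And>s. (b has_vector_derivative b' s) (at s)"
      and cont: "continuous_on UNIV a'" "continuous_on UNIV b'" and b: "b u \<noteq> 0"
    for a b a' b' :: "real \<Rightarrow> complex" and u :: real
  proof -
    have c: "continuous_on UNIV a" "continuous_on UNIV b" "continuous_on UNIV g"
      using d assms(3) by (auto intro!: continuous_at_imp_continuous_on has_vector_derivative_continuous)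
    have "open {s. b s \<noteq> 0}"
      by (rule open_Collect_neq[OF c(2) continuous_on_const])
    with b obtain e where e: "e > 0" "cball u e \<subseteq> {s. b s \<noteq> 0}"
      unfolding open_contains_cball by blast
    have "(\<lambda>s. vector [a s / b s, g s * (b s)\<^sup>2] :: complex^2) C1_differentiable_on (cball u e \<inter> {0..1})"
      unfolding C1_differentiable_on_def
    proof (intro exI conjI ballI)
      show "((\<lambda>s. vector [a s / b s, g s * (b s)\<^sup>2] :: complex^2) has_vector_derivative
        vector [(a' s * b s - a s * b' s) / (b s)\<^sup>2, g' s * (b s)\<^sup>2 + g s * (2 * b s * b' s)]) (at s)"
        if "s \<in> cball u e \<inter> {0..1}" for s
        using that e by (intro has_vector_derivative_chart d assms(3)) auto
      show "continuous_on (cball u e \<inter> {0..1}) (\<lambda>s. vector [(a' s * b s - a s * b' s) / (b s)\<^sup>2,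
          g' s * (b s)\<^sup>2 + g s * (2 * b s * b' s)] :: complex^2)"
        using e by (intro continuous_on_vec2 continuous_intros continuous_on_subset[OF c(1)]
          continuous_on_subset[OF c(2)] continuous_on_subset[OF c(3)] continuous_on_subset[OF cont(1)]
          continuous_on_subset[OF cont(2)] continuous_on_subset[OF assms(6)]) auto
    qed
    with e show ?thesis
      by (auto intro: C1_differentiable_imp_piecewise)
  qed
  have A: "H2_coord Affine \<circ> (\<lambda>s. H2_class (a s) (b s) (g s)) = (\<lambda>s. vector [a s / b s, g s * (b s)\<^sup>2])"
    and I: "H2_coord Infinity \<circ> (\<lambda>s. H2_class (a s) (b s) (g s)) = (\<lambda>s. vector [b s / a s, g s * (a s)\<^sup>2])"
    using nz by (simp_all add: fun_eq_iff H2_coord_class del: H2_coord.simps)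
  show ?thesis
    unfolding H2_path_def
  proof
    fix u :: real
    show "\<exists>i. \<exists>e>0. (\<lambda>s. H2_class (a s) (b s) (g s)) ` (cball u e \<inter> {0..1}) \<subseteq> H2_dom i \<and>
      (H2_coord i \<circ> (\<lambda>s. H2_class (a s) (b s) (g s))) piecewise_C1_differentiable_on (cball u e \<inter> {0..1})"
    proof (cases "b u = 0")
      case False
      from nbhd[OF d(1,2) cont(1,2) this] show ?thesis
        using nz unfolding A[symmetric]
        by (intro exI[of _ Affine], elim exE conjE, intro exI conjI) (auto simp: H2_dom_def H2_proj_class simp del: H2_coord.simps split: if_splits)
    next
      case True
      with nz[of u] have "a u \<noteq> 0" by simp
      from nbhd[OF d(2,1) cont(2,1) this] show ?thesis
        using nz unfolding I[symmetric]
        by (intro exI[of _ Infinity], elim exE conjE, intro exI conjI) (auto simp: H2_dom_def H2_proj_class simp del: H2_coord.simps split: if_splits)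
    qed
  qed
qed

lemma continuous_on_eh_norm_sq_hom:
  assumes t: "t > 0" and [continuous_intros]: "continuous_on A a" "continuous_on A b" "continuous_on A g"
    "continuous_on A a'" "continuous_on A b'" "continuous_on A g'"
    and nz: "\<And>z. (a z, b z) \<noteq> (0, 0)"
  shows "continuous_on A (\<lambda>z. eh_norm_sq_hom t (a z, b z, g z) (a' z, b' z, g' z))"
proof -
  define M where "M z = (cmod (a z))\<^sup>2 + (cmod (b z))\<^sup>2" for z
  define S where "S z = sqrt ((cmod (g z) * M z)\<^sup>2 + t^4)" for z
  have M: "M z \<noteq> 0" for z
    using nz[of z] by (auto simp: M_def add_nonneg_eq_0_iff)
  have S: "S z \<noteq> 0" for z
  proof -
    have "(cmod (g z) * M z)\<^sup>2 + t^4 > 0" using t by (intro add_nonneg_pos) auto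
    then show ?thesis by (simp add: S_def)
  qed
  have [continuous_intros]: "continuous_on A M"
    unfolding M_def[abs_def] by (intro continuous_intros)
  have [continuous_intros]: "continuous_on A S"
    unfolding S_def[abs_def] by (intro continuous_intros)
  have "continuous_on A (\<lambda>z. 2 * (S z * (cmod (a' z * b z - a z * b' z) / M z)\<^sup>2 +
             (cmod (of_real (M z / 2) * g' z + g z * (cnj (a z) * a' z + cnj (b z) * b' z)))\<^sup>2 / S z))"
    by (intro continuous_intros ballI M S) simp
  then show ?thesis
    by (simp only: eh_norm_sq_hom_def Let_def split S_def M_def)
qed

section \<open>Curves with a lift to homogeneous coordinates\<close>

text \<open>The Wronskian in \<open>immersed\<close> is, up to sign, the numerator of the derivative
  of the projected curve in either chart, so the assumption says that this curve is regular.\<close>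

locale lifted_curve =
  fixes \<alpha> \<beta> \<alpha>' \<beta>' :: "real \<Rightarrow> complex"
  assumes deriv: "\<And>s. (\<alpha> has_vector_derivative \<alpha>' s) (at s)" "\<And>s. (\<beta> has_vector_derivative \<beta>' s) (at s)"
    and cont': "continuous_on UNIV \<alpha>'" "continuous_on UNIV \<beta>'"
    and nz: "\<And>s. (\<alpha> s, \<beta> s) \<noteq> (0, 0)"
    and immersed: "\<And>s. \<alpha>' s * \<beta> s - \<alpha> s * \<beta>' s \<noteq> 0"
begin

definition curve :: "real \<Rightarrow> complex option" where
  "curve s = (if \<beta> s = 0 then None else Some (\<alpha> s / \<beta> s))"

definition lift_norm_sq :: "real \<Rightarrow> real" where
  "lift_norm_sq s = (cmod (\<alpha> s))\<^sup>2 + (cmod (\<beta> s))\<^sup>2"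

text \<open>The speed in the Fubini-Study metric of the projective line. Unlike the speed in a
  chart, it depends continuously on the parameter even across infinity.\<close>

definition spherical_speed :: "real \<Rightarrow> real" where
  "spherical_speed s = cmod (\<alpha>' s * \<beta> s - \<alpha> s * \<beta>' s) / lift_norm_sq s"

text \<open>The homogeneous coordinate that the chart selected by \<open>chart_at\<close> normalises
  to 1.\<close>

definition fibre_scale :: "real \<Rightarrow> complex" where
  "fibre_scale s = (if \<beta> s = 0 then \<alpha> s else \<beta> s)"

text \<open>The value of \<open>eh_N\<close> in the selected chart. It may jump where the chart
  changes, so only its measurability is established.\<close>

definition fibre_norm :: "real \<Rightarrow> real" where
  "fibre_norm s = lift_norm_sq s / (cmod (fibre_scale s))\<^sup>2"

lemma cont: "continuous_on UNIV \<alpha>" "continuous_on UNIV \<beta>"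
  using deriv by (auto intro!: continuous_at_imp_continuous_on has_vector_derivative_continuous)

lemma lift_norm_sq_pos: "lift_norm_sq s > 0"
  using nz[of s] unfolding lift_norm_sq_def by (auto simp: add_pos_nonneg add_nonneg_pos)

lemma fibre_scale_nz: "fibre_scale s \<noteq> 0"
  using nz[of s] by (auto simp: fibre_scale_def)

lemma fibre_norm_pos: "fibre_norm s > 0"
  using lift_norm_sq_pos[of s] fibre_scale_nz[of s] by (simp add: fibre_norm_def)

lemma cont_lift_norm_sq: "continuous_on UNIV lift_norm_sq"
  unfolding lift_norm_sq_def[abs_def] by (intro continuous_intros cont)

lemma cont_spherical_speed: "continuous_on UNIV spherical_speed"
  unfolding spherical_speed_def[abs_def] using lift_norm_sq_pos
  by (intro continuous_intros cont cont' cont_lift_norm_sq) (auto simp: less_imp_neq[THEN not_sym])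

lemma spherical_speed_pos: "spherical_speed s > 0"
  using lift_norm_sq_pos[of s] immersed[of s] by (simp add: spherical_speed_def)

lemma measurable_fibre_norm [measurable]: "fibre_norm \<in> borel_measurable borel"
proof -
  have [measurable]: "\<alpha> \<in> borel_measurable borel" "\<beta> \<in> borel_measurable borel" "lift_norm_sq \<in> borel_measurable borel"
    using cont cont_lift_norm_sq by (auto intro: borel_measurable_continuous_onI)
  show ?thesis
    unfolding fibre_norm_def[abs_def] fibre_scale_def by measurable
qed

section \<open>The parametrisation of \<open>M3\<close> expressed by the lift\<close>

lemma point_eq: "H2_point (chart_at (curve s)) (M3_coord curve s w) = H2_class (\<alpha> s) (\<beta> s) (w / (fibre_scale s)\<^sup>2)"
proof (cases "\<beta> s = 0")
  case True
  with nz[of s] H2_class_scale[of 1 0 "\<alpha> s" "w / (\<alpha> s)\<^sup>2"] show ?thesis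
    by (simp add: chart_at_def curve_def M3_coord_def fibre_scale_def)
next
  case False
  with H2_class_scale[of "\<alpha> s / \<beta> s" 1 "\<beta> s" "w / (\<beta> s)\<^sup>2"] show ?thesis
    by (simp add: chart_at_def curve_def M3_coord_def fibre_scale_def)
qed

lemma u1_point: "eh_u1 (H2_point (chart_at (curve s)) (M3_coord curve s w)) = cmod w * fibre_norm s"
  using nz[of s] by (simp add: point_eq eh_u1_class fibre_norm_def lift_norm_sq_def norm_divide norm_power)

lemma eh_N_coord: "eh_N (M3_coord curve s w) = fibre_norm s"
  using nz[of s] by (auto simp: eh_N_def M3_coord_def chart_at_def curve_def fibre_norm_def lift_norm_sq_def fibre_scale_def norm_divide field_simps)

lemma cmod_vector_derivative_curve:
  "cmod (vector_derivative (P1_coord (chart_at (curve s)) \<circ> curve) (at s)) = spherical_speed s * fibre_norm s"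
proof -
  show ?thesis
  proof (cases "\<beta> s = 0")
    case True
    with nz[of s] have a: "\<alpha> s \<noteq> 0" by simp
    \<comment> \<open>An equality of total functions: at zeros of \<alpha> both sides are 0.\<close>
    have "P1_coord Infinity \<circ> curve = (\<lambda>s. \<beta> s / \<alpha> s)"
      by (simp add: fun_eq_iff curve_def)
    then show ?thesis
      using vector_derivative_at[OF has_vector_derivative_quotient[OF deriv(2,1) a]] True a lift_norm_sq_pos[of s] norm_minus_commute[of "\<beta>' s * \<alpha> s" "\<beta> s * \<alpha>' s"]
      by (simp add: chart_at_def curve_def spherical_speed_def fibre_norm_def fibre_scale_def norm_divide norm_power mult.commute)
  next
    case False
    \<comment> \<open>The affine coordinate of \<open>None\<close> is unspecified, so the quotient
      formula is only used near \<open>s\<close>, where \<beta> does not vanish.\<close>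
    have "eventually (\<lambda>\<tau>. \<beta> \<tau> \<noteq> 0) (at s)"
      using False cont(2) by (auto simp: continuous_on_eq_continuous_at isCont_def intro: tendsto_imp_eventually_ne)
    then have "eventually (\<lambda>\<tau>. \<alpha> \<tau> / \<beta> \<tau> = (P1_coord Affine \<circ> curve) \<tau>) (at s)"
      by eventually_elim (simp add: curve_def)
    then have "((P1_coord Affine \<circ> curve) has_vector_derivative (\<alpha>' s * \<beta> s - \<alpha> s * \<beta>' s) / (\<beta> s)\<^sup>2) (at s)"
      using has_vector_derivative_quotient[OF deriv False] False unfolding has_vector_derivative_def
      by (elim has_derivative_transform_eventually) (auto simp: curve_def)
    from vector_derivative_at[OF this] show ?thesis
      using False lift_norm_sq_pos[of s]
      by (simp add: chart_at_def curve_def spherical_speed_def fibre_norm_def fibre_scale_def norm_divide norm_power)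
  qed
qed

lemma density_eq:
  assumes "t > 0"
  shows "M3_density t curve s w = spherical_speed s * (fibre_norm s)\<^sup>2 / sqrt (2 * sqrt ((cmod w * fibre_norm s)\<^sup>2 + t^4))"
  unfolding M3_density_eq[OF assms] cmod_vector_derivative_curve eh_N_coord eh_S_def
  by (simp add: power2_eq_square M3_coord_def mult_ac)

section \<open>Volume bounds from above and below\<close>

lemma spherical_speed_bounds:
  obtains k K where "k > 0" "K > 0" "\<And>s. s \<in> {0..1} \<Longrightarrow> k \<le> spherical_speed s \<and> spherical_speed s \<le> K"
proof -
  have c: "continuous_on {0..1} spherical_speed" by (rule continuous_on_subset[OF cont_spherical_speed]) simp
  obtain a where a: "\<forall>s\<in>{0..1}. spherical_speed a \<le> spherical_speed s"
    using continuous_attains_inf[OF _ _ c] by auto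
  obtain b where b: "\<forall>s\<in>{0..1}. spherical_speed s \<le> spherical_speed b"
    using continuous_attains_sup[OF _ _ c] by auto
  show thesis
    using that[of "spherical_speed a" "spherical_speed b"] a b spherical_speed_pos by blast
qed

text \<open>The density is at most \<open>K / t\<close> times the square of
  \<open>fibre_norm\<close>, which is the weight of \<open>disc_bundle_integral\<close>, and by
  \<open>u1_point\<close> the preimage of \<open>B\<close> lies in the disc bundle of radius
  \<open>r\<close>.\<close>

lemma vol_le:
  assumes t: "t > 0" and r: "r \<ge> 0" and B: "\<And>x. x \<in> B \<Longrightarrow> eh_u1 x \<le> r"
    and K: "\<And>s. s \<in> {0..1} \<Longrightarrow> spherical_speed s \<le> K"
  shows "M3_vol t curve B \<le> ennreal (K / t * (pi * r\<^sup>2))"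
proof -
  have K0: "K \<ge> 0" using K[of 0] spherical_speed_pos[of 0] by simp
  have d: "M3_density t curve s w \<le> K / t * (fibre_norm s)\<^sup>2" if "0 \<le> s" "s < 1" for s w
  proof -
    \<comment> \<open>The denominator \<open>sqrt (2 * S)\<close> is at least \<open>t\<close>,
      since \<open>S\<close> is at least \<open>t^2\<close>.\<close>
    have "t\<^sup>2 \<le> sqrt ((cmod w * fibre_norm s)\<^sup>2 + t^4)"
      by (rule real_le_rsqrt) (simp add: power_mult[symmetric])
    also have "\<dots> \<le> 2 * sqrt ((cmod w * fibre_norm s)\<^sup>2 + t^4)"
      by simp
    finally have "t \<le> sqrt (2 * sqrt ((cmod w * fibre_norm s)\<^sup>2 + t^4))"
      by (rule real_le_rsqrt)
    then have "spherical_speed s * (fibre_norm s)\<^sup>2 / sqrt (2 * sqrt ((cmod w * fibre_norm s)\<^sup>2 + t^4)) \<le> K * (fibre_norm s)\<^sup>2 / t"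
      using K[of s] that t K0 by (intro frac_le mult_right_mono) auto
    then show ?thesis by (simp add: density_eq[OF t])
  qed
  have "M3_vol t curve B \<le> (\<integral>\<^sup>+ z. ennreal (K / t) * ((case z of (s, w) \<Rightarrow> ennreal ((fibre_norm s)\<^sup>2)) *
      indicator {(s, w :: complex). 0 \<le> s \<and> s < 1 \<and> cmod w * fibre_norm s \<le> r} z) \<partial>lborel)"
    unfolding M3_vol_def
    by (intro nn_integral_mono)
       (use d B K0 t in \<open>auto simp: indicator_def ennreal_mult'[symmetric] intro!: ennreal_leI simp flip: u1_point\<close>)
  also have "\<dots> = ennreal (K / t) * (\<integral>\<^sup>+ z. ((case z of (s, w) \<Rightarrow> ennreal ((fibre_norm s)\<^sup>2)) *
      indicator {(s, w :: complex). 0 \<le> s \<and> s < 1 \<and> cmod w * fibre_norm s \<le> r} z) \<partial>lborel)"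
    by (rule nn_integral_cmult) (simp add: borel_prod[symmetric] case_prod_beta)
  also have "\<dots> = ennreal (K / t * (pi * r\<^sup>2))"
    unfolding disc_bundle_integral[OF measurable_fibre_norm fibre_norm_pos r]
    by (rule ennreal_mult'[symmetric]) (use K0 t in simp)
  finally show ?thesis .
qed

text \<open>The hypothesis on \<open>B\<close> says that it contains the part of
  \<open>M3 curve\<close> over \<open>0 \<le> s < 1\<close> with \<open>eh_u1\<close> at most 1.
  There \<open>S\<close> is at most \<open>sqrt (1 + t^4)\<close>, which bounds the density from
  below.\<close>

lemma vol_ge:
  assumes t: "t > 0" and B: "\<And>s \<gamma>. 0 \<le> s \<Longrightarrow> s < 1 \<Longrightarrow> cmod \<gamma> * lift_norm_sq s \<le> 1 \<Longrightarrow> H2_class (\<alpha> s) (\<beta> s) \<gamma> \<in> B"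
    and k: "\<And>s. s \<in> {0..1} \<Longrightarrow> k \<le> spherical_speed s" and k0: "k > 0"
  shows "ennreal (k / sqrt (2 * sqrt (1 + t^4)) * pi) \<le> M3_vol t curve B"
proof -
  define C where "C = k / sqrt (2 * sqrt (1 + t^4))"
  have C0: "C \<ge> 0" using k0 t by (simp add: C_def)
  have d: "C * (fibre_norm s)\<^sup>2 \<le> M3_density t curve s w" if "0 \<le> s" "s < 1" "cmod w * fibre_norm s \<le> 1" for s w
  proof -
    have "(cmod w * fibre_norm s)\<^sup>2 \<le> 1"
      using that fibre_norm_pos[of s] by (simp add: power_le_one)
    moreover have "0 < (cmod w * fibre_norm s)\<^sup>2 + t^4"
      using t by (intro add_nonneg_pos) auto
    ultimately have "k * (fibre_norm s)\<^sup>2 / sqrt (2 * sqrt (1 + t^4)) \<le> spherical_speed s * (fibre_norm s)\<^sup>2 / sqrt (2 * sqrt ((cmod w * fibre_norm s)\<^sup>2 + t^4))"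
      using k[of s] that k0 by (intro frac_le mult_right_mono real_sqrt_le_mono mult_left_mono) auto
    then show ?thesis by (simp add: density_eq[OF t] C_def)
  qed
  have mem: "H2_point (chart_at (curve s)) (M3_coord curve s w) \<in> B" if "0 \<le> s" "s < 1" "cmod w * fibre_norm s \<le> 1" for s w
    unfolding point_eq using that by (intro B) (auto simp: fibre_norm_def norm_divide norm_power)
  have "ennreal (C * pi) = ennreal C * (\<integral>\<^sup>+ z. ((case z of (s, w) \<Rightarrow> ennreal ((fibre_norm s)\<^sup>2)) *
      indicator {(s, w :: complex). 0 \<le> s \<and> s < 1 \<and> cmod w * fibre_norm s \<le> 1} z) \<partial>lborel)"
    unfolding disc_bundle_integral[OF measurable_fibre_norm fibre_norm_pos zero_le_one]
    using C0 by (simp add: ennreal_mult')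
  also have "\<dots> = (\<integral>\<^sup>+ z. ennreal C * ((case z of (s, w) \<Rightarrow> ennreal ((fibre_norm s)\<^sup>2)) *
      indicator {(s, w :: complex). 0 \<le> s \<and> s < 1 \<and> cmod w * fibre_norm s \<le> 1} z) \<partial>lborel)"
    by (rule nn_integral_cmult[symmetric]) (simp add: borel_prod[symmetric] case_prod_beta)
  also have "\<dots> \<le> M3_vol t curve B"
    unfolding M3_vol_def
    by (intro nn_integral_mono)
       (use d mem C0 in \<open>auto simp: indicator_def ennreal_mult'[symmetric] intro!: ennreal_leI\<close>)
  finally show ?thesis by (simp add: C_def)
qed

section \<open>Bounds for the distance from a base point\<close>

lemma mem_M3_class: "H2_class (\<alpha> s) (\<beta> s) \<gamma> \<in> M3 curve"
  using nz[of s] by (simp add: M3_def H2_proj_class curve_def)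

lemma M3_cases:
  assumes "q \<in> M3 curve"
  obtains s \<gamma> where "q = H2_class (\<alpha> s) (\<beta> s) \<gamma>"
proof -
  obtain s where s: "H2_proj q = curve s"
    using assms by (auto simp: M3_def)
  obtain a b g where q: "(a, b) \<noteq> (0, 0)" "q = H2_class a b g"
    by (rule H2_cases)
  have "\<exists>l. l \<noteq> 0 \<and> a = l * \<alpha> s \<and> b = l * \<beta> s"
  proof (cases "b = 0")
    case True
    with q s have "\<beta> s = 0" by (auto simp: H2_proj_class curve_def split: if_splits)
    with True q nz[of s] show ?thesis
      by (intro exI[of _ "a / \<alpha> s"]) auto
  next
    case False
    with q s have "\<beta> s \<noteq> 0" "a / b = \<alpha> s / \<beta> s"
      by (auto simp: H2_proj_class curve_def split: if_splits)
    with False show ?thesis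
      by (intro exI[of _ "b / \<beta> s"]) (auto simp: field_simps)
  qed
  then obtain l where "l \<noteq> 0" "a = l * \<alpha> s" "b = l * \<beta> s" by blast
  with q H2_class_scale[OF nz[of s], of l g] that show thesis by simp
qed

text \<open>The velocities \<delta> of the base parameter and \<gamma>' of the fibre coordinate are
  free arguments, so one compact set controls all connecting paths at once.\<close>

lemma cont_norm_hom:
  assumes t: "t > 0"
  shows "continuous_on UNIV (\<lambda>(u, \<gamma>, \<gamma>', \<delta>). eh_norm_sq_hom t (\<alpha> u, \<beta> u, \<gamma>) (\<delta> * \<alpha>' u, \<delta> * \<beta>' u, \<gamma>'))"
proof -
  have c: "continuous_on UNIV (\<lambda>z :: real \<times> complex \<times> complex \<times> complex. f (fst z))"
    if "continuous_on UNIV f" for f :: "real \<Rightarrow> complex"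
    by (rule continuous_on_compose2[OF that continuous_on_fst[OF continuous_on_id]]) simp
  have "continuous_on UNIV (\<lambda>z :: real \<times> complex \<times> complex \<times> complex. snd (snd (snd z)) * f (fst z))"
    if "continuous_on UNIV f" for f :: "real \<Rightarrow> complex"
    by (rule continuous_on_mult[OF _ c[OF that]]) (intro continuous_on_snd continuous_on_id)
  note c' = this[OF cont'(1)] this[OF cont'(2)]
  have "continuous_on UNIV (\<lambda>z. eh_norm_sq_hom t (\<alpha> (fst z), \<beta> (fst z), fst (snd z))
      (snd (snd (snd z)) * \<alpha>' (fst z), snd (snd (snd z)) * \<beta>' (fst z), fst (snd (snd z))))"
    by (rule continuous_on_eh_norm_sq_hom[OF t c[OF cont(1)] c[OF cont(2)] _ c' _ nz])
       (intro continuous_on_fst continuous_on_snd continuous_on_id)+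
  then show ?thesis
    by (simp only: case_prod_beta')
qed

text \<open>The endpoints are joined by a segment in the parameters \<open>(s, \<gamma>)\<close> of
  the lift. Its speed is a continuous function of data from a compact set, hence bounded uniformly
  in the endpoint.\<close>

lemma dist_bounded:
  assumes t: "t > 0"
  shows "\<exists>L\<ge>0. \<forall>s\<in>{0..1}. \<forall>\<gamma>\<in>cball 0 c.
    M3_dist t curve (H2_class (\<alpha> s0) (\<beta> s0) \<gamma>0) (H2_class (\<alpha> s) (\<beta> s) \<gamma>) \<le> ennreal L"
proof -
  define \<Phi> where "\<Phi> = (\<lambda>(u, \<gamma>, \<gamma>', \<delta>). eh_norm_sq_hom t (\<alpha> u, \<beta> u, \<gamma>) (\<delta> * \<alpha>' u, \<delta> * \<beta>' u, \<gamma>'))"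
  \<comment> \<open>Ranges for the base parameter and fibre coordinate along the segment, and for
    the constant velocities \<open>\<gamma> - \<gamma>0\<close> and \<open>s - s0\<close>.\<close>
  define P where "P = {-\<bar>s0\<bar>..\<bar>s0\<bar> + 1} \<times> cball (0::complex) (cmod \<gamma>0 + \<bar>c\<bar>) \<times>
    cball (0::complex) (cmod \<gamma>0 + \<bar>c\<bar>) \<times> cball (0::complex) (\<bar>s0\<bar> + 1)"
  have "compact P"
    unfolding P_def by (intro compact_Times compact_Icc compact_cball)
  then have "bounded (\<Phi> ` P)"
    using continuous_on_subset[OF cont_norm_hom[OF t] subset_UNIV]
    by (intro compact_imp_bounded compact_continuous_image) (auto simp: \<Phi>_def)
  then obtain L where L: "\<And>z. z \<in> P \<Longrightarrow> \<bar>\<Phi> z\<bar> \<le> L"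
    unfolding bounded_iff by auto
  have "M3_dist t curve (H2_class (\<alpha> s0) (\<beta> s0) \<gamma>0) (H2_class (\<alpha> s) (\<beta> s) \<gamma>) \<le> ennreal (sqrt \<bar>L\<bar>)"
    if s: "s \<in> {0..1}" and \<gamma>: "\<gamma> \<in> cball 0 c" for s \<gamma>
  proof -
    define u where "u = (\<lambda>\<tau>. s0 + \<tau> * (s - s0))"
    define g where "g = (\<lambda>\<tau>. \<gamma>0 + of_real \<tau> * (\<gamma> - \<gamma>0))"
    define y where "y = (\<lambda>\<tau>. H2_class (\<alpha> (u \<tau>)) (\<beta> (u \<tau>)) (g \<tau>))"
    have du: "(u has_real_derivative (s - s0)) (at \<tau>)" for \<tau>
      unfolding u_def by (auto intro!: derivative_eq_intros)
    have d: "((\<lambda>\<tau>. f (u \<tau>)) has_vector_derivative of_real (s - s0) * f' (u \<tau>)) (at \<tau>)"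
      if "\<And>s. (f has_vector_derivative f' s) (at s)" for f f' :: "real \<Rightarrow> complex" and \<tau>
      using vector_diff_chain_at[OF du[unfolded has_real_derivative_iff_has_vector_derivative] that]
      by (simp add: comp_def scaleR_conv_of_real)
    have dg: "(g has_vector_derivative (\<gamma> - \<gamma>0)) (at \<tau>)" for \<tau>
      unfolding g_def has_vector_derivative_def
      by (auto intro!: derivative_eq_intros simp: scaleR_conv_of_real)
    have cu: "continuous_on UNIV u" unfolding u_def by (intro continuous_intros)
    have "H2_path y"
      unfolding y_def
      by (rule H2_path_class[OF d[OF deriv(1)] d[OF deriv(2)] dg])
         (intro continuous_intros continuous_on_compose2[OF cont'(1) cu] continuous_on_compose2[OF cont'(2) cu] subset_UNIV nz)+
    moreover have "y ` {0..1} \<subseteq> M3 curve"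
      using mem_M3_class by (auto simp: y_def)
    moreover have "y 0 = H2_class (\<alpha> s0) (\<beta> s0) \<gamma>0" "y 1 = H2_class (\<alpha> s) (\<beta> s) \<gamma>"
      by (simp_all add: y_def u_def g_def)
    ultimately have "M3_dist t curve (H2_class (\<alpha> s0) (\<beta> s0) \<gamma>0) (H2_class (\<alpha> s) (\<beta> s) \<gamma>) \<le> eh_length t y"
      unfolding M3_dist_def by (intro INF_lower) auto
    \<comment> \<open>The path is parametrised by the unit interval, so a bound for the speed is one
      for the length.\<close>
    also have "\<dots> \<le> (\<integral>\<^sup>+ \<tau>\<in>{0..1::real}. ennreal (sqrt \<bar>L\<bar>) \<partial>lborel)"
      unfolding eh_length_def
    proof (rule nn_integral_mono)
      fix \<tau> :: real
      show "ennreal (eh_speed t y \<tau>) * indicator {0..1} \<tau> \<le> ennreal (sqrt \<bar>L\<bar>) * indicator {0..1} \<tau>"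
      proof (cases "\<tau> \<in> {0..1}")
        case True
        have "u \<tau> = (1 - \<tau>) * s0 + \<tau> * s" "\<bar>\<tau>\<bar> \<le> 1"
          using True by (auto simp: u_def algebra_simps)
        have u: "u \<tau> \<in> {-\<bar>s0\<bar>..\<bar>s0\<bar> + 1}"
        proof -
          have "\<bar>(1 - \<tau>) * s0\<bar> \<le> \<bar>s0\<bar>" "0 \<le> \<tau> * s" "\<tau> * s \<le> 1"
            using True s by (auto simp: abs_mult mult_le_one mult_left_le_one_le)
          then show ?thesis unfolding \<open>u \<tau> = _\<close> by (auto simp: abs_le_iff)
        qed
        have gn: "g \<tau> \<in> cball 0 (cmod \<gamma>0 + \<bar>c\<bar>)"
        proof -
          have "g \<tau> = of_real (1 - \<tau>) * \<gamma>0 + of_real \<tau> * \<gamma>"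
            by (simp add: g_def algebra_simps)
          then have "cmod (g \<tau>) \<le> (1 - \<tau>) * cmod \<gamma>0 + \<tau> * cmod \<gamma>"
            using True by (metis (no_types, lifting) abs_of_nonneg atLeastAtMost_iff diff_ge_0_iff_ge norm_mult norm_of_real norm_triangle_ineq)
          also have "\<dots> \<le> cmod \<gamma>0 + \<bar>c\<bar>"
            using True \<gamma> by (intro add_mono) (auto intro: mult_left_le_one_le order_trans[OF mult_left_le_one_le])
          finally show ?thesis by simp
        qed
        have "(u \<tau>, g \<tau>, \<gamma> - \<gamma>0, of_real (s - s0)) \<in> P"
          using u gn s \<gamma> norm_triangle_ineq4[of \<gamma> \<gamma>0] norm_of_real[of "s - s0", where 'a = complex]
          unfolding P_def by (auto simp del: norm_of_real)
        from L[OF this] have "\<Phi> (u \<tau>, g \<tau>, \<gamma> - \<gamma>0, of_real (s - s0)) \<le> \<bar>L\<bar>"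
          by simp
        then have "eh_speed t y \<tau> \<le> sqrt \<bar>L\<bar>"
          unfolding y_def eh_speed_class[OF t d[OF deriv(1)] d[OF deriv(2)] dg nz]
          by (simp add: \<Phi>_def)
        then show ?thesis using True by (simp add: ennreal_leI)
      qed simp
    qed
    also have "\<dots> = ennreal (sqrt \<bar>L\<bar>)"
      by (subst nn_integral_cmult_indicator) auto
    finally show ?thesis .
  qed
  then show ?thesis
    by (intro exI[of _ "sqrt \<bar>L\<bar>"]) auto
qed

lemma ball_contains:
  assumes t: "t > 0" and q: "q \<in> M3 curve"
  obtains R0 where "\<And>R s \<gamma>. R \<ge> R0 \<Longrightarrow> 0 \<le> s \<Longrightarrow> s < 1 \<Longrightarrow> cmod \<gamma> * lift_norm_sq s \<le> 1 \<Longrightarrow>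
    H2_class (\<alpha> s) (\<beta> s) \<gamma> \<in> M3_ball t curve q R"
proof -
  obtain s0 \<gamma>0 where q: "q = H2_class (\<alpha> s0) (\<beta> s0) \<gamma>0"
    using q by (rule M3_cases)
  have "continuous_on {0..1} lift_norm_sq" by (rule continuous_on_subset[OF cont_lift_norm_sq]) simp
  then obtain a where a: "\<forall>s\<in>{0..1}. lift_norm_sq a \<le> lift_norm_sq s"
    using continuous_attains_inf[of "{0..1}" lift_norm_sq] by auto
  \<comment> \<open>By the choice of \<open>a\<close>, a point over the unit interval with
    \<open>eh_u1\<close> at most 1 has fibre coordinate of modulus at most
    \<open>1 / lift_norm_sq a\<close>.\<close>
  obtain L where L: "L \<ge> 0" "\<And>s \<gamma>. s \<in> {0..1} \<Longrightarrow> \<gamma> \<in> cball 0 (1 / lift_norm_sq a) \<Longrightarrow>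
      M3_dist t curve q (H2_class (\<alpha> s) (\<beta> s) \<gamma>) \<le> ennreal L"
    using dist_bounded[OF t] unfolding q by metis
  show thesis
  \<comment> \<open>The ball is defined by a strict inequality, so its radius has to exceed
    \<open>L\<close>.\<close>
  proof (rule that[of "L + 1"])
    fix R s \<gamma> assume *: "R \<ge> L + 1" "0 \<le> s" "s < 1" "cmod \<gamma> * lift_norm_sq s \<le> 1"
    have "cmod \<gamma> * lift_norm_sq a \<le> cmod \<gamma> * lift_norm_sq s"
      using a * by (intro mult_left_mono) auto
    then have "cmod \<gamma> \<le> 1 / lift_norm_sq a"
      using * lift_norm_sq_pos[of a] by (simp add: field_simps)
    then have "M3_dist t curve q (H2_class (\<alpha> s) (\<beta> s) \<gamma>) \<le> ennreal L"
      using * by (intro L(2)) auto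
    also have "\<dots> < ennreal R"
      using * L(1) by (simp add: ennreal_less_iff)
    finally show "H2_class (\<alpha> s) (\<beta> s) \<gamma> \<in> M3_ball t curve q R"
      using mem_M3_class by (simp add: M3_ball_def)
  qed
qed

text \<open>For large \<open>R\<close> the volume lies between a positive constant and a multiple of
  \<open>R^4\<close>, so its logarithm divided by \<open>R\<close> is squeezed to 0.\<close>

lemma subexponential_growth:
  assumes t: "t > 0"
  shows "M3_subexponential_growth t curve"
  unfolding M3_subexponential_growth_def
proof
  fix q assume q: "q \<in> M3 curve"
  obtain k K where k: "k > 0" and K: "K > 0" and kK: "\<And>s. s \<in> {0..1} \<Longrightarrow> k \<le> spherical_speed s \<and> spherical_speed s \<le> K"
    by (rule spherical_speed_bounds) blast
  obtain R0 where R0: "\<And>R s \<gamma>. R \<ge> R0 \<Longrightarrow> 0 \<le> s \<Longrightarrow> s < 1 \<Longrightarrow> cmod \<gamma> * lift_norm_sq s \<le> 1 \<Longrightarrow>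
      H2_class (\<alpha> s) (\<beta> s) \<gamma> \<in> M3_ball t curve q R"
    using ball_contains[OF t q] by blast
  define V where "V R = M3_vol t curve (M3_ball t curve q R)" for R
  define c where "c = k / sqrt (2 * sqrt (1 + t^4)) * pi"
  define C where "C = K / t * pi"
  define a where "a = eh_rho t q"
  have c: "c > 0" using k by (auto simp: c_def intro!: mult_pos_pos divide_pos_pos add_pos_nonneg)
  have C: "C > 0" using K t by (simp add: C_def)
  have a: "a \<ge> 0" by (simp add: a_def eh_rho_def)
  have lower: "ennreal c \<le> V R" if "R \<ge> R0" for R
    unfolding V_def c_def by (rule vol_ge[OF t _ _ k]) (use R0 that kK in auto)
  have upper: "V R \<le> ennreal (C * (a + R)^4)" if "R \<ge> 0" for R
  proof -
    \<comment> \<open>The fourth power arises because \<open>eh_u1\<close> is at most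
      \<open>(a + R)^2\<close> on the ball and a disc area is quadratic in its radius.\<close>
    have "V R \<le> ennreal (K / t * (pi * ((a + R)\<^sup>2)\<^sup>2))"
      unfolding V_def a_def by (rule vol_le[OF t]) (use kK u1_le_on_ball[OF t _ that] in auto)
    then show ?thesis
      by (simp add: C_def mult.assoc flip: power_mult)
  qed
  define v where "v R = enn2real (V R)" for R
  have ev: "eventually (\<lambda>R. ereal (1 / R) * ennreal_log (V R) = ereal (ln (v R) / R) \<and>
      ln c / R \<le> ln (v R) / R \<and> ln (v R) / R \<le> ln (16 * C) / R + 4 * (ln R / R)) at_top"
    using eventually_ge_at_top[of R0] eventually_gt_at_top[of 0] eventually_ge_at_top[of a]
  proof eventually_elim
    case (elim R)
    \<comment> \<open>Finiteness and the positive lower bound put \<open>ennreal_log\<close> into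
      its real branch.\<close>
    have fin: "V R \<noteq> \<infinity>"
      using upper[of R] elim by (auto simp: top_unique)
    then have v: "V R = ennreal (v R)" "v R \<ge> 0"
      by (simp_all add: v_def less_top)
    have cv: "c \<le> v R"
      using lower[OF elim(1)] v by (simp add: ennreal_le_iff)
    have vC: "v R \<le> C * (a + R)^4"
      using upper[of R] elim C a v by (simp add: ennreal_le_iff)
    have "ennreal_log (V R) = ereal (ln (v R))"
      using c cv v fin by (auto simp: ennreal_log_def)
    moreover have "ln c \<le> ln (v R)"
      using c cv by simp
    moreover have "ln (v R) \<le> ln (16 * C) + 4 * ln R"
    proof -
      \<comment> \<open>Here \<open>R \<ge> a\<close> is used; the constant 16 is
        \<open>2^4\<close>.\<close>
      have "(a + R)^4 \<le> (2 * R)^4"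
        using a elim by (intro power_mono) auto
      then have "C * (a + R)^4 \<le> 16 * C * R^4"
        using C by (simp add: power_mult_distrib)
      with vC have "v R \<le> 16 * C * R^4"
        by linarith
      then have "ln (v R) \<le> ln (16 * C * R^4)"
        using c cv by simp
      also have "\<dots> = ln (16 * C) + 4 * ln R"
        using C elim by (simp add: ln_mult ln_realpow)
      finally show ?thesis .
    qed
    ultimately show ?case
      using elim divide_right_mono[of "ln (v R)" "ln (16 * C) + 4 * ln R" R]
      by (simp add: divide_right_mono add_divide_distrib)
  qed
  have "((\<lambda>R. ln (v R) / R) \<longlongrightarrow> 0) at_top"
  proof (rule tendsto_sandwich)
    show "eventually (\<lambda>R. ln c / R \<le> ln (v R) / R) at_top" "eventually (\<lambda>R. ln (v R) / R \<le> ln (16 * C) / R + 4 * (ln R / R)) at_top"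
      using ev by (auto elim: eventually_mono)
    have l: "((\<lambda>R::real. d / R) \<longlongrightarrow> 0) at_top" for d :: real
      by (rule tendsto_divide_0[OF tendsto_const filterlim_at_top_imp_at_infinity[OF filterlim_ident]])
    show "((\<lambda>R. ln c / R) \<longlongrightarrow> 0) at_top"
      by (rule l)
    show "((\<lambda>R. ln (16 * C) / R + 4 * (ln R / R)) \<longlongrightarrow> 0) at_top"
      using tendsto_add[OF l[of "ln (16 * C)"] tendsto_mult[OF tendsto_const[of 4] ln_x_over_x_tendsto_0]]
      by simp
  qed
  then have "((\<lambda>R. ereal (ln (v R) / R)) \<longlongrightarrow> ereal 0) at_top"
    by (simp only: lim_ereal)
  then have "((\<lambda>R. ereal (1 / R) * ennreal_log (V R)) \<longlongrightarrow> ereal 0) at_top"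
    by (rule Lim_transform_eventually) (use ev in \<open>auto elim: eventually_mono\<close>)
  then show "M3_growth t curve q = 0"
    unfolding M3_growth_def V_def by (simp add: lim_imp_Limsup zero_ereal_def)
qed

end

section \<open>Moebius images of smooth closed curves\<close>

theorem corollary6:
  fixes t :: real and A :: "complex^2^2" and c :: "real \<Rightarrow> complex"
  assumes "t > 0"
    and "A \<in> unitary_group2"
    and "smooth_closed_curve c"
  shows "M3_subexponential_growth t (\<lambda>s. P1_moebius A (Some (c s)))"
proof -
  define c' where "c' = (\<lambda>s. vector_derivative c (at s))"
  have smooth: "((\<lambda>h u. vector_derivative h (at u)) ^^ n) c differentiable (at s)" for n s
    using assms(3) by (simp add: smooth_closed_curve_def)
  have c': "(c has_vector_derivative c' s) (at s)" for s
    using smooth[of 0 s] by (simp add: c'_def vector_derivative_works)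
  have "c' differentiable (at s)" for s
    using smooth[of 1 s] by (simp add: c'_def)
  then have cont: "continuous_on UNIV c'"
    by (auto intro!: continuous_at_imp_continuous_on differentiable_imp_continuous_within)
  have nz: "c' s \<noteq> 0" for s
    using assms(3) by (simp add: smooth_closed_curve_def c'_def)
  have "A ** (\<chi> j k. cnj (A$k$j)) = mat 1"
    using assms(2) by (simp add: unitary_group2_def)
  then have "det A * det (\<chi> j k. cnj (A$k$j)) = 1"
    by (metis det_mul det_I)
  then have det: "A$1$1 * A$2$2 - A$1$2 * A$2$1 \<noteq> 0"
    by (auto simp: det_2)
  \<comment> \<open>The lift is \<open>A\<close> applied to the vector
    \<open>(c s, 1)\<close>.\<close>
  interpret lifted_curve "\<lambda>s. A$1$1 * c s + A$1$2" "\<lambda>s. A$2$1 * c s + A$2$2"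
    "\<lambda>s. A$1$1 * c' s" "\<lambda>s. A$2$1 * c' s"
  proof
    fix s
    show "((\<lambda>s. A$1$1 * c s + A$1$2) has_vector_derivative A$1$1 * c' s) (at s)"
      "((\<lambda>s. A$2$1 * c s + A$2$2) has_vector_derivative A$2$1 * c' s) (at s)"
      using c'[of s] by (auto intro!: derivative_eq_intros)
    show "A$1$1 * c' s * (A$2$1 * c s + A$2$2) - (A$1$1 * c s + A$1$2) * (A$2$1 * c' s) \<noteq> 0"
    proof -
      \<comment> \<open>The Wronskian of the lift is the determinant of \<open>A\<close> times the
        velocity of \<open>c\<close>.\<close>
      have "A$1$1 * c' s * (A$2$1 * c s + A$2$2) - (A$1$1 * c s + A$1$2) * (A$2$1 * c' s)
        = (A$1$1 * A$2$2 - A$1$2 * A$2$1) * c' s"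
        by (simp add: algebra_simps)
      with det nz[of s] show ?thesis by simp
    qed
    show "(A$1$1 * c s + A$1$2, A$2$1 * c s + A$2$2) \<noteq> (0, 0)"
    proof
      assume "(A$1$1 * c s + A$1$2, A$2$1 * c s + A$2$2) = (0, 0)"
      \<comment> \<open>The second column of \<open>A\<close> would be a multiple of the first,
        contradicting invertibility.\<close>
      then have "A$1$2 = - (A$1$1 * c s)" "A$2$2 = - (A$2$1 * c s)"
        by (simp_all add: add_eq_0_iff)
      with det show False by simp
    qed
  qed (intro continuous_intros cont)+
  have "(\<lambda>s. P1_moebius A (Some (c s))) = curve"
    by (simp add: fun_eq_iff P1_moebius_def curve_def)
  then show ?thesis
    using subexponential_growth[OF assms(1)] by simp
qed

end
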